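(* Let $A$ be a coherent quantale. Then the following are equivalent: (1) $A$ is $B$-normal; (2) $R(A)$ is a $B$-normal frame; (3) the reticulation $L(A)$ is a $B$-normal lattice; (4) for all distinct $p,q\in Max(A)$ there exists $e\in B(A)$ such that $e\leq p$ and $\neg e\leq q$; (5) $A$ is a normal quantale and $Max_Z(A)$ is a zero-dimensional space; (6) $A$ is a normal quantale and $Max_Z(A)$ is a Boolean space; (7) the family $(D(e)\cap Max(A))_{e\in B(A)}$ is a basis of open sets for $Max_Z(A)$; (8) the function $s_A|_{Max(A)}: Max_Z(A)\to Sp(A)$ is a homeomorphism.
   Context: A quantale here means a complete lattice $A$ with bottom $0$ and top $1$, with an associative commutative multiplication that distributes over arbitrary joins and has $1$ as unit; a frame is a quantale whose multiplication is the meet. $K(A)$ is the set of compact elements. $A$ is coherent if every element is a join of compact elements, $1\in K(A)$, and $K(A)$ is closed under multiplication. $p<1$ is $m$-prime if for all $a,b\in A$, $ab\leq p$ implies $a\leq p$ or $b\leq p$; $Spec(A)$ is the set of $m$-prime elements. $Max(A)$ is the set of maximal elements of $A\setminus\{1\}$; for coherent $A$, $Max(A)\subseteq Spec(A)$. $B(A)$ is the Boolean algebra of complemented elements of $A$ (those $e$ with some $f$ such that $e\vee f=1$, $e\wedge f=0$), $\neg e$ being the complement of $e$; $B(L)$ is defined likewise for a bounded distributive lattice $L$. Topology: $D(a)=\{p\in Spec(A): a\not\leq p\}$; $Spec_Z(A)$ is $Spec(A)$ with open sets $D(a)$, $a\in A$; $Max_Z(A)$ is $Max(A)$ as a subspace.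 Zero-dimensional means having a basis of clopen sets; a Boolean space is a compact Hausdorff zero-dimensional space. Normality: $A$ is normal if for all $a,b\in A$ with $a\vee b=1$ there are $e,f\in A$ with $a\vee e=b\vee f=1$ and $ef=0$. $A$ is $B$-normal if for all $c,d\in K(A)$ with $c\vee d=1$ there are $e,f\in B(A)$ with $c\vee e=d\vee f=1$ and $ef=0$; a $B$-normal frame is a frame that is $B$-normal as a quantale. A bounded distributive lattice $L$ is $B$-normal if for all $x,y\in L$ with $x\vee y=1$ there are $e,f\in B(L)$ with $x\vee e=y\vee f=1$ and $e\wedge f=0$. Radical elements: $\rho(a)=\bigwedge\{p\in Spec(A): a\leq p\}$; $R(A)=\{a\in A: \rho(a)=a\}$, a coherent frame with order inherited from $A$, joins $\rho(\bigvee a_i)$, meets as in $A$, bottom $\rho(0)$. Reticulation: the (unique up to isomorphism) bounded distributive lattice $L(A)$ with a surjection $\lambda_A: K(A)\to L(A)$ such that for all $a,b\in K(A)$: $\lambda_A(a\vee b)\leq\lambda_A(a)\vee\lambda_A(b)$; $\lambda_A(ab)=\lambda_A(a)\wedge\lambda_A(b)$; and $\lambda_A(a)\leq\lambda_A(b)$ iff $a^n\leq b$ for some integer $n\geq1$. Pierce spectrum: an element of $A$ is regular if it is a join of elements of $B(A)$; a max-regular element is a maximal element of the set of regular elements $\neq 1$. $Sp(A)$ is the set of max-regular elements, with the topology having the sets $U(e)=\{p\in Sp(A): e\not\leq p\}$, $e\in B(A)$, as basis of open sets. $s_A: Spec(A)\to Sp(A)$ is $s_A(p)=\bigvee\{e\in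 B(A): e\leq p\}$ (which is max-regular). *)

theory Defs
  imports "HOL-Analysis.Analysis"
begin

section \<open>Complemented elements\<close>

definition complemented_elements :: "'a::bounded_lattice set" where
  "complemented_elements = {e. \<exists>f. sup e f = top \<and> inf e f = bot}"

definition complement :: "'a::bounded_lattice \<Rightarrow> 'a" where
  "complement e = (THE f. sup e f = top \<and> inf e f = bot)"


section \<open>Coherent quantales\<close>

definition (in complete_lattice) compact_element :: "'a \<Rightarrow> bool" where
  "compact_element c \<longleftrightarrow> (\<forall>X. c \<le> Sup X \<longrightarrow> (\<exists>F. F \<subseteq> X \<and> finite F \<and> c \<le> Sup F))"

class quantale = complete_lattice + comm_monoid_mult +
  assumes one_eq_top: "1 = top"
    and mult_Sup: "a * Sup X = (SUP x\<in>X. a * x)"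

class frame = quantale +
  assumes mult_eq_inf: "a * b = inf a b"

class coherent_quantale = quantale +
  assumes join_of_compact: "\<exists>X. (\<forall>c\<in>X. compact_element c) \<and> a = Sup X"
    and compact_top: "compact_element top"
    and compact_mult: "compact_element a \<Longrightarrow> compact_element b \<Longrightarrow> compact_element (a * b)"

context quantale
begin

lemma mult_bot: "a * bot = bot"
  using mult_Sup[of a "{}"] by simp

lemma mult_sup: "a * sup b c = sup (a * b) (a * c)"
  using mult_Sup[of a "{b, c}"] by simp

lemma mult_top: "a * top = a"
  using one_eq_top by (metis mult_1_right)

lemma mult_mono_right: "b \<le> c \<Longrightarrow> a * b \<le> a * c"
  by (metis mult_sup sup.absorb_iff2)

lemma mult_mono_both: "a \<le> b \<Longrightarrow> c \<le> d \<Longrightarrow> a * c \<le> b * d"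
  by (metis mult_mono_right mult.commute order_trans)

lemma mult_le_left: "a * b \<le> a"
  by (metis mult_mono_right mult_top top_greatest)

lemma mult_le_right: "a * b \<le> b"
  using mult_le_left[of b a] by (simp add: mult.commute)

lemma sup_mult: "sup a b * c = sup (a * c) (b * c)"
  using mult_sup[of c a b] by (simp add: mult.commute)

lemma mult_le_inf: "a * b \<le> inf a b"
  by (simp add: mult_le_left mult_le_right)

lemma le_mult_le: "a \<le> p \<Longrightarrow> a * b \<le> p" "b \<le> p \<Longrightarrow> a * b \<le> p"
  using mult_le_left mult_le_right order_trans by blast+

end

lemma complement_unique:
  fixes e :: "'a::quantale"
  assumes "sup e f = top" "inf e f = bot" "sup e g = top" "inf e g = bot"
  shows "f = g"
proof -
  have le: "x \<le> y" if "sup e y = top" "inf e x = bot" for x y :: 'a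
  proof -
    have "x * e \<le> bot" using mult_le_inf[of x e] that by (simp add: inf.commute)
    then have "x = x * y"
      using mult_sup[of x e y] that(1) by (simp add: mult_top bot_unique)
    then show ?thesis by (metis mult_le_right)
  qed
  show ?thesis by (rule order_antisym; rule le; fact assms)
qed

lemma complement_eqI:
  fixes e :: "'a::quantale"
  assumes "sup e f = top" "inf e f = bot"
  shows "complement e = f"
  unfolding complement_def using assms complement_unique by (intro the_equality) blast+


section \<open>Normality\<close>

definition normal_quantale :: "'a::quantale itself \<Rightarrow> bool" where
  "normal_quantale _ \<longleftrightarrow> (\<forall>a b :: 'a. sup a b = top \<longrightarrow>
     (\<exists>e f. sup a e = top \<and> sup b f = top \<and> e * f = bot))"

definition B_normal :: "'a::quantale itself \<Rightarrow> bool" where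
  "B_normal _ \<longleftrightarrow> (\<forall>c d :: 'a. compact_element c \<longrightarrow> compact_element d \<longrightarrow> sup c d = top \<longrightarrow>
     (\<exists>e\<in>complemented_elements. \<exists>f\<in>complemented_elements.
        sup c e = top \<and> sup d f = top \<and> e * f = bot))"

definition B_normal_frame :: "'a::frame itself \<Rightarrow> bool" where
  "B_normal_frame = B_normal"

definition B_normal_lattice :: "'l::{distrib_lattice,bounded_lattice} itself \<Rightarrow> bool" where
  "B_normal_lattice _ \<longleftrightarrow> (\<forall>x y :: 'l. sup x y = top \<longrightarrow>
     (\<exists>e\<in>complemented_elements. \<exists>f\<in>complemented_elements.
        sup x e = top \<and> sup y f = top \<and> inf e f = bot))"


section \<open>Spectra\<close>

definition Spec :: "'a::quantale set" where
  "Spec = {p. p < top \<and> (\<forall>a b. a * b \<le> p \<longrightarrow> a \<le> p \<or> b \<le> p)}"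

definition Max_Spec :: "'a::quantale set" where
  "Max_Spec = {m. m \<noteq> top \<and> (\<forall>x. x \<noteq> top \<longrightarrow> m \<le> x \<longrightarrow> x = m)}"

definition basic_open :: "'a::quantale \<Rightarrow> 'a set" where
  "basic_open a = {p \<in> Spec. \<not> a \<le> p}"

definition Spec_Z :: "'a::quantale topology" where
  "Spec_Z = topology (\<lambda>U. \<exists>a. U = basic_open a)"

definition Max_Z :: "'a::quantale topology" where
  "Max_Z = subtopology Spec_Z Max_Spec"

lemma Spec_mult_le_iff: "p \<in> Spec \<Longrightarrow> a * b \<le> p \<longleftrightarrow> a \<le> p \<or> b \<le> p"
  unfolding Spec_def using le_mult_le by blast

lemma openin_Spec_Z: "openin Spec_Z U \<longleftrightarrow> (\<exists>a. U = basic_open a)"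
proof -
  have "basic_open a \<inter> basic_open b = basic_open (a * b)" for a b :: 'a
    by (auto simp: basic_open_def Spec_mult_le_iff)
  then have int: "\<exists>c. basic_open a \<inter> basic_open b = basic_open c" for a b :: 'a
    by blast
  have un: "\<exists>a. \<Union>\<U> = basic_open a" if *: "\<forall>U\<in>\<U>. \<exists>a. U = basic_open a" for \<U> :: "'a set set"
  proof -
    have Sup: "p \<in> basic_open (Sup S) \<longleftrightarrow> (\<exists>a\<in>S. p \<in> basic_open a)" for p :: 'a and S
      by (auto simp: basic_open_def Sup_le_iff)
    have "p \<in> \<Union>\<U> \<longleftrightarrow> p \<in> basic_open (Sup {a. basic_open a \<in> \<U>})" for p
    proof
      assume "p \<in> \<Union>\<U>"
      then obtain V where "V \<in> \<U>" "p \<in> V" by blast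
      moreover obtain a where "V = basic_open a" using * \<open>V \<in> \<U>\<close> by blast
      ultimately show "p \<in> basic_open (Sup {a. basic_open a \<in> \<U>})" unfolding Sup by blast
    next
      assume "p \<in> basic_open (Sup {a. basic_open a \<in> \<U>})"
      then show "p \<in> \<Union>\<U>" unfolding Sup by blast
    qed
    then have "\<Union>\<U> = basic_open (Sup {a. basic_open a \<in> \<U>})" by (rule set_eqI)
    then show ?thesis by blast
  qed
  have "istopology (\<lambda>U. \<exists>a::'a. U = basic_open a)"
    unfolding istopology_def using int un by blast
  then show ?thesis by (simp add: Spec_Z_def)
qed

lemma topspace_Spec_Z: "topspace Spec_Z = Spec"
proof -
  have "openin Spec_Z (Spec :: 'a::quantale set)"
    unfolding openin_Spec_Z by (rule exI[of _ top]) (auto simp: basic_open_def Spec_def less_le_not_le)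
  moreover have "topspace Spec_Z \<subseteq> (Spec :: 'a set)"
    unfolding topspace_def openin_Spec_Z basic_open_def by auto
  ultimately show ?thesis by (meson openin_subset subset_antisym)
qed

lemma Max_Spec_subset_Spec: "Max_Spec \<subseteq> (Spec :: 'a::quantale set)"
proof
  fix m :: 'a assume m: "m \<in> Max_Spec"
  have "a \<le> m \<or> b \<le> m" if "a * b \<le> m" for a b
  proof (rule ccontr)
    assume "\<not> (a \<le> m \<or> b \<le> m)"
    moreover have "sup m x = top" if "\<not> x \<le> m" for x
    proof (rule ccontr)
      assume "sup m x \<noteq> top"
      then have "sup m x = m" using m by (simp add: Max_Spec_def)
      then show False using that by (simp add: sup.absorb_iff1)
    qed
    ultimately have "top = sup m a * sup m b" by (simp add: mult_top)
    also have "\<dots> = sup (sup m a * m) (sup (m * b) (a * b))"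
      by (simp add: mult_sup sup_mult)
    also have "\<dots> \<le> m"
      using that by (simp add: mult_le_left mult_le_right)
    finally show False using m by (simp add: Max_Spec_def top_unique)
  qed
  then show "m \<in> Spec" using m by (simp add: Spec_def Max_Spec_def top.not_eq_extremum)
qed

definition is_basis :: "'b topology \<Rightarrow> 'b set set \<Rightarrow> bool" where
  "is_basis X \<B> \<longleftrightarrow> openin X = arbitrary union_of (\<lambda>U. U \<in> \<B>)"

definition zero_dimensional_space :: "'b topology \<Rightarrow> bool" where
  "zero_dimensional_space X \<longleftrightarrow>
     (\<exists>\<B>. is_basis X \<B> \<and> (\<forall>U\<in>\<B>. openin X U \<and> closedin X U))"

definition Boolean_space :: "'b topology \<Rightarrow> bool" where
  "Boolean_space X \<longleftrightarrow> compact_space X \<and> Hausdorff_space X \<and> zero_dimensional_space X"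


section \<open>The frame of radical elements\<close>

definition rho :: "'a::quantale \<Rightarrow> 'a" where
  "rho a = Inf {p \<in> Spec. a \<le> p}"

lemma le_rho: "a \<le> rho a"
  unfolding rho_def by (auto intro: Inf_greatest)

lemma rho_le_iff_prime: "p \<in> Spec \<Longrightarrow> rho a \<le> p \<longleftrightarrow> a \<le> p"
  using le_rho[of a] by (auto simp: rho_def intro: Inf_lower order_trans)

lemma le_rho_iff: "b \<le> rho a \<longleftrightarrow> (\<forall>p\<in>Spec. a \<le> p \<longrightarrow> b \<le> p)"
  unfolding rho_def by (auto simp: le_Inf_iff)

lemma rho_mono: "a \<le> b \<Longrightarrow> rho a \<le> rho b"
  by (meson le_rho_iff order_trans le_rho rho_le_iff_prime)

lemma rho_idem: "rho (rho a) = rho a"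
  by (simp add: order_antisym le_rho le_rho_iff rho_le_iff_prime)

text \<open>The order on \<open>'a radical\<close> is that of \<open>'a\<close>, so its elements are the \<open>a\<close> with \<open>rho a = a\<close>,
  and the instance proofs below determine its joins and meets.\<close>

typedef (overloaded) 'a radical = "{a :: 'a::quantale. rho a = a}"
  morphisms of_radical Abs_radical
  by (rule exI[of _ top]) (simp add: le_rho top_unique order_antisym)

lemma rho_of_radical: "rho (of_radical x) = of_radical x"
  using of_radical[of x] by simp

lemma of_radical_Abs_rho: "of_radical (Abs_radical (rho a)) = rho a"
  by (simp add: Abs_radical_inverse rho_idem)

lemma rho_inf: "rho a = a \<Longrightarrow> rho b = b \<Longrightarrow> rho (inf a b) = inf a b"
  using rho_mono[of "inf a b" a] rho_mono[of "inf a b" b] le_rho[of "inf a b"]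
  by (simp add: order_antisym)

lemma rho_Inf: "(\<And>x. x \<in> X \<Longrightarrow> rho x = x) \<Longrightarrow> rho (Inf X) = Inf X"
  by (metis Inf_greatest Inf_lower le_rho order_antisym rho_mono)

instantiation radical :: (quantale) frame
begin

definition less_eq_radical :: "'a radical \<Rightarrow> 'a radical \<Rightarrow> bool" where
  "x \<le> y \<longleftrightarrow> of_radical x \<le> of_radical y"
definition less_radical :: "'a radical \<Rightarrow> 'a radical \<Rightarrow> bool" where
  "x < y \<longleftrightarrow> of_radical x < of_radical y"
definition inf_radical :: "'a radical \<Rightarrow> 'a radical \<Rightarrow> 'a radical" where
  "inf x y = Abs_radical (inf (of_radical x) (of_radical y))"
definition sup_radical :: "'a radical \<Rightarrow> 'a radical \<Rightarrow> 'a radical" where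
  "sup x y = Abs_radical (rho (sup (of_radical x) (of_radical y)))"
definition Inf_radical :: "'a radical set \<Rightarrow> 'a radical" where
  "Inf X = Abs_radical (Inf (of_radical ` X))"
definition Sup_radical :: "'a radical set \<Rightarrow> 'a radical" where
  "Sup X = Abs_radical (rho (Sup (of_radical ` X)))"
definition bot_radical :: "'a radical" where
  "bot = Abs_radical (rho bot)"
definition top_radical :: "'a radical" where
  "top = Abs_radical top"
definition one_radical :: "'a radical" where
  "1 = (top :: 'a radical)"
definition times_radical :: "'a radical \<Rightarrow> 'a radical \<Rightarrow> 'a radical" where
  "x * y = (inf x y :: 'a radical)"

lemma of_radical_inf: "of_radical (inf x y :: 'a radical) = inf (of_radical x) (of_radical y)"
  unfolding inf_radical_def by (simp add: Abs_radical_inverse rho_inf rho_of_radical)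

lemma of_radical_sup: "of_radical (sup x y :: 'a radical) = rho (sup (of_radical x) (of_radical y))"
  unfolding sup_radical_def by (simp add: of_radical_Abs_rho)

lemma of_radical_Inf: "of_radical (Inf X :: 'a radical) = Inf (of_radical ` X)"
  unfolding Inf_radical_def by (intro Abs_radical_inverse) (auto intro!: rho_Inf rho_of_radical)

lemma of_radical_Sup: "of_radical (Sup X :: 'a radical) = rho (Sup (of_radical ` X))"
  unfolding Sup_radical_def by (simp add: of_radical_Abs_rho)

lemma of_radical_bot: "of_radical (bot :: 'a radical) = rho bot"
  unfolding bot_radical_def by (simp add: of_radical_Abs_rho)

lemma of_radical_top: "of_radical (top :: 'a radical) = top"
  unfolding top_radical_def
  by (intro Abs_radical_inverse) (simp add: le_rho top_unique order_antisym)

lemma rho_le_of_radical: "rho a \<le> of_radical x \<longleftrightarrow> a \<le> of_radical x"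
  by (metis le_rho order_trans rho_mono rho_of_radical)

lemma inf_rho_Sup:
  fixes x :: "'a radical"
  shows "inf (of_radical x) (rho (Sup Y)) \<le> rho (SUP y\<in>Y. inf (of_radical x) y)"
proof -
  have "inf (of_radical x) (rho (Sup Y)) \<le> p"
    if p: "p \<in> Spec" and le: "(SUP y\<in>Y. inf (of_radical x) y) \<le> p" for p
  proof (cases "of_radical x \<le> p")
    case True
    then show ?thesis by (meson inf.cobounded1 order_trans)
  next
    case False
    have "y \<le> p" if "y \<in> Y" for y
    proof -
      have "of_radical x * y \<le> p"
        using le that by (meson SUP_le_iff mult_le_inf order_trans)
      then show ?thesis using p False by (auto simp: Spec_def)
    qed
    then have "rho (Sup Y) \<le> p" by (simp add: Sup_le_iff rho_le_iff_prime[OF p])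
    then show ?thesis by (meson inf.cobounded2 order_trans)
  qed
  then show ?thesis by (simp add: le_rho_iff)
qed

instance
proof
  fix a b c x y z :: "'a radical" and X :: "'a radical set"
  show "(x < y) = (x \<le> y \<and> \<not> y \<le> x)"
    unfolding less_radical_def less_eq_radical_def by (rule less_le_not_le)
  show "x \<le> x" by (simp add: less_eq_radical_def)
  show "x \<le> y \<Longrightarrow> y \<le> z \<Longrightarrow> x \<le> z" by (simp add: less_eq_radical_def)
  show "x \<le> y \<Longrightarrow> y \<le> x \<Longrightarrow> x = y"
    by (simp add: less_eq_radical_def of_radical_inject order_antisym)
  show "inf x y \<le> x" "inf x y \<le> y" by (simp_all add: less_eq_radical_def of_radical_inf)
  show "x \<le> y \<Longrightarrow> x \<le> z \<Longrightarrow> x \<le> inf y z" by (simp add: less_eq_radical_def of_radical_inf)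
  show "x \<le> sup x y" "y \<le> sup x y"
    by (simp_all add: less_eq_radical_def of_radical_sup) (meson le_rho order_trans sup_ge1 sup_ge2)+
  show "y \<le> x \<Longrightarrow> z \<le> x \<Longrightarrow> sup y z \<le> x"
    by (simp add: less_eq_radical_def of_radical_sup rho_le_of_radical)
  show "x \<in> X \<Longrightarrow> Inf X \<le> x" by (simp add: less_eq_radical_def of_radical_Inf INF_lower)
  show "(\<And>x. x \<in> X \<Longrightarrow> z \<le> x) \<Longrightarrow> z \<le> Inf X"
    by (simp add: less_eq_radical_def of_radical_Inf le_INF_iff)
  show "x \<in> X \<Longrightarrow> x \<le> Sup X"
    by (simp add: less_eq_radical_def of_radical_Sup) (meson le_rho order_trans SUP_upper)
  show "(\<And>x. x \<in> X \<Longrightarrow> x \<le> z) \<Longrightarrow> Sup X \<le> z"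
    by (simp add: less_eq_radical_def of_radical_Sup rho_le_of_radical SUP_le_iff)
  show "Inf ({} :: 'a radical set) = top" "Sup ({} :: 'a radical set) = bot"
    by (simp_all add: of_radical_inject[symmetric] of_radical_Inf of_radical_Sup of_radical_top
        of_radical_bot)
  show "a * b * c = a * (b * c)" "a * b = b * a" "1 * a = a"
    by (simp_all add: of_radical_inject[symmetric] times_radical_def one_radical_def
        of_radical_inf of_radical_top inf.assoc inf.commute inf.left_commute)
  show "1 = (top :: 'a radical)" by (rule one_radical_def)
  show "a * b = inf a b" by (rule times_radical_def)
  show "a * Sup X = (SUP x\<in>X. a * x)"
  proof -
    have "inf (of_radical a) (rho (Sup (of_radical ` X))) =
      rho (SUP x\<in>X. inf (of_radical a) (of_radical x))" (is "?l = rho ?r")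
    proof (rule order_antisym)
      show "?l \<le> rho ?r" using inf_rho_Sup[of a "of_radical ` X"] by (simp add: image_image)
      have "?r \<le> of_radical a" by (simp add: SUP_le_iff)
      moreover have "?r \<le> Sup (of_radical ` X)" by (meson SUP_mono inf.cobounded2)
      ultimately show "rho ?r \<le> ?l" by (simp add: rho_le_of_radical rho_mono)
    qed
    then show ?thesis
      by (simp add: of_radical_inject[symmetric] of_radical_Sup times_radical_def of_radical_inf
          image_image)
  qed
qed

end


section \<open>The reticulation\<close>

text \<open>Only the values of \<open>l\<close> on compact elements matter.\<close>

definition is_reticulation :: "('a::quantale \<Rightarrow> 'l::{distrib_lattice,bounded_lattice}) \<Rightarrow> bool" where
  "is_reticulation l \<longleftrightarrow>
     l ` {a. compact_element a} = UNIV \<and>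
     (\<forall>a b. compact_element a \<longrightarrow> compact_element b \<longrightarrow>
        l (sup a b) \<le> sup (l a) (l b) \<and>
        l (a * b) = inf (l a) (l b) \<and>
        (l a \<le> l b \<longleftrightarrow> (\<exists>n\<ge>1. a ^ n \<le> b)))"

text \<open>Existence: the lattice of the sets \<open>{c. c \<in> K(A), c^n \<le> a for some n \<ge> 1}\<close>, \<open>a \<in> K(A)\<close>, is a
  reticulation.\<close>

lemma (in quantale) power_mono_quantale: "a \<le> b \<Longrightarrow> a ^ n \<le> b ^ n"
  by (induction n) (auto intro: mult_mono_both)

lemma (in quantale) sup_power_le: "sup a b ^ (n + m) \<le> sup (a ^ n) (b ^ m)"
proof (induction "n + m" arbitrary: n m)
  case 0
  then show ?case by simp
next
  case (Suc k)
  show ?case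
  proof (cases "n = 0 \<or> m = 0")
    case True
    then have "a ^ n = top \<or> b ^ m = top" by (auto simp: one_eq_top[symmetric])
    then show ?thesis by (metis sup_top_left sup_top_right top_greatest)
  next
    case False
    then obtain n' m' where nm: "n = Suc n'" "m = Suc m'" by (metis not0_implies_Suc)
    have "a * sup a b ^ k \<le> a * sup (a ^ n') (b ^ m)"
      using Suc.hyps(1)[of n' m] Suc.hyps(2) nm by (intro mult_mono_right) simp
    also have "\<dots> \<le> sup (a ^ n) (b ^ m)"
      unfolding mult_sup nm(1) power_Suc
      by (intro sup_mono order_refl mult_le_right)
    finally have 1: "a * sup a b ^ k \<le> sup (a ^ n) (b ^ m)" .
    have "b * sup a b ^ k \<le> b * sup (a ^ n) (b ^ m')"
      using Suc.hyps(1)[of n m'] Suc.hyps(2) nm by (intro mult_mono_right) simp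
    also have "\<dots> \<le> sup (a ^ n) (b ^ m)"
      unfolding mult_sup nm(2) power_Suc
      by (intro sup_mono order_refl mult_le_right)
    finally have 2: "b * sup a b ^ k \<le> sup (a ^ n) (b ^ m)" .
    have "sup a b ^ (n + m) = sup (a * sup a b ^ k) (b * sup a b ^ k)"
      using Suc.hyps(2)[symmetric] by (simp add: sup_mult)
    then show ?thesis using 1 2 by simp
  qed
qed

lemma (in complete_lattice) compact_element_bot: "compact_element bot"
  unfolding compact_element_def by (auto intro: exI[of _ "{}"])

lemma (in complete_lattice) compact_element_sup:
  assumes "compact_element a" "compact_element b"
  shows "compact_element (sup a b)"
  unfolding compact_element_def
proof (intro allI impI)
  fix X assume "sup a b \<le> Sup X"
  then have "a \<le> Sup X" "b \<le> Sup X" by auto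
  then obtain F G where F: "F \<subseteq> X" "finite F" "a \<le> Sup F" and G: "G \<subseteq> X" "finite G" "b \<le> Sup G"
    using assms unfolding compact_element_def by metis
  then have "F \<union> G \<subseteq> X \<and> finite (F \<union> G) \<and> sup a b \<le> Sup (F \<union> G)"
    by (simp add: Sup_union_distrib le_supI1 le_supI2)
  then show "\<exists>H. H \<subseteq> X \<and> finite H \<and> sup a b \<le> Sup H" by blast
qed

definition compact_roots :: "'a::coherent_quantale \<Rightarrow> 'a set" where
  "compact_roots a = {c. compact_element c \<and> (\<exists>n\<ge>1. c ^ n \<le> a)}"

typedef (overloaded) 'a reticulation =
  "compact_roots ` {a :: 'a::coherent_quantale. compact_element a}"
  morphisms roots_of Abs_reticulation
  using compact_element_bot by blast

definition reticulate :: "'a::coherent_quantale \<Rightarrow> 'a reticulation" where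
  "reticulate a = Abs_reticulation (compact_roots a)"

definition representative :: "'a::coherent_quantale reticulation \<Rightarrow> 'a" where
  "representative x = (SOME a. compact_element a \<and> reticulate a = x)"

lemma roots_of_reticulate: "compact_element a \<Longrightarrow> roots_of (reticulate a) = compact_roots a"
  unfolding reticulate_def by (simp add: Abs_reticulation_inverse)

lemma representative:
  "compact_element (representative x)" "reticulate (representative x) = x"
proof -
  have "\<exists>a. compact_element a \<and> reticulate a = x"
    using roots_of[of x] unfolding reticulate_def by (metis imageE mem_Collect_eq roots_of_inverse)
  then have "compact_element (representative x) \<and> reticulate (representative x) = x"
    unfolding representative_def by (rule someI_ex)
  then show "compact_element (representative x)" "reticulate (representative x) = x" by auto
qed

lemma compact_roots_subset_iff:
  fixes a b :: "'a::coherent_quantale"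
  assumes "compact_element a"
  shows "compact_roots a \<subseteq> compact_roots b \<longleftrightarrow> (\<exists>n\<ge>1. a ^ n \<le> b)"
proof
  assume "compact_roots a \<subseteq> compact_roots b"
  moreover have "a \<in> compact_roots a"
    unfolding compact_roots_def using assms by (auto intro: exI[of _ 1])
  ultimately show "\<exists>n\<ge>1. a ^ n \<le> b" by (auto simp: compact_roots_def)
next
  assume "\<exists>n\<ge>1. a ^ n \<le> b"
  then obtain n where n: "n \<ge> 1" "a ^ n \<le> b" by blast
  have "\<exists>k\<ge>1. c ^ k \<le> b" if "m \<ge> 1" "c ^ m \<le> a" for c m
  proof (intro exI conjI)
    show "m * n \<ge> 1" using n that by simp
    show "c ^ (m * n) \<le> b"
      unfolding power_mult using power_mono_quantale[OF that(2)] n(2) order_trans by blast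
  qed
  then show "compact_roots a \<subseteq> compact_roots b" by (auto simp: compact_roots_def)
qed

instantiation reticulation :: (coherent_quantale) "{distrib_lattice,bounded_lattice}"
begin

definition less_eq_reticulation :: "'a reticulation \<Rightarrow> 'a reticulation \<Rightarrow> bool" where
  "x \<le> y \<longleftrightarrow> roots_of x \<subseteq> roots_of y"
definition less_reticulation :: "'a reticulation \<Rightarrow> 'a reticulation \<Rightarrow> bool" where
  "x < y \<longleftrightarrow> roots_of x \<subset> roots_of y"
definition inf_reticulation :: "'a reticulation \<Rightarrow> 'a reticulation \<Rightarrow> 'a reticulation" where
  "inf x y = reticulate (representative x * representative y)"
definition sup_reticulation :: "'a reticulation \<Rightarrow> 'a reticulation \<Rightarrow> 'a reticulation" where
  "sup x y = reticulate (sup (representative x) (representative y))"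
definition bot_reticulation :: "'a reticulation" where
  "bot = reticulate bot"
definition top_reticulation :: "'a reticulation" where
  "top = reticulate top"

lemma reticulate_le_iff:
  fixes a b :: 'a
  assumes "compact_element a" "compact_element b"
  shows "reticulate a \<le> reticulate b \<longleftrightarrow> (\<exists>n\<ge>1. a ^ n \<le> b)"
  unfolding less_eq_reticulation_def using assms
  by (simp add: roots_of_reticulate compact_roots_subset_iff)

lemma reticulate_mono:
  fixes a b :: 'a
  assumes "compact_element a" "compact_element b" "a \<le> b"
  shows "reticulate a \<le> reticulate b"
  unfolding reticulate_le_iff[OF assms(1,2)] using assms(3) by (intro exI[of _ 1]) simp

lemma reticulate_le_mult:
  fixes a b c :: 'a
  assumes "compact_element a" "compact_element b" "compact_element c"
    and "reticulate c \<le> reticulate a" "reticulate c \<le> reticulate b"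
  shows "reticulate c \<le> reticulate (a * b)"
proof -
  obtain n m where "n \<ge> 1" "c ^ n \<le> a" "m \<ge> 1" "c ^ m \<le> b"
    using assms by (auto simp: reticulate_le_iff)
  then have "n + m \<ge> 1 \<and> c ^ (n + m) \<le> a * b" by (simp add: power_add mult_mono_both)
  then show ?thesis using assms by (auto simp: reticulate_le_iff compact_mult)
qed

lemma reticulate_sup_le:
  fixes a b c :: 'a
  assumes "compact_element a" "compact_element b" "compact_element c"
    and "reticulate a \<le> reticulate c" "reticulate b \<le> reticulate c"
  shows "reticulate (sup a b) \<le> reticulate c"
proof -
  obtain n m where nm: "n \<ge> 1" "a ^ n \<le> c" "m \<ge> 1" "b ^ m \<le> c"
    using assms by (auto simp: reticulate_le_iff)
  have "sup a b ^ (n + m) \<le> c" using sup_power_le[of a b n m] nm by (meson le_supI order_trans)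
  then have "n + m \<ge> 1 \<and> sup a b ^ (n + m) \<le> c" using nm by simp
  then show ?thesis using assms by (auto simp: reticulate_le_iff compact_element_sup)
qed

instance
proof
  fix x y z :: "'a reticulation"
  note c = representative(1) compact_mult compact_element_sup compact_element_bot compact_top
  show "(x < y) = (x \<le> y \<and> \<not> y \<le> x)"
    unfolding less_reticulation_def less_eq_reticulation_def by auto
  show "x \<le> x" by (simp add: less_eq_reticulation_def)
  show "x \<le> y \<Longrightarrow> y \<le> z \<Longrightarrow> x \<le> z" by (auto simp: less_eq_reticulation_def)
  show antisym: "x \<le> y \<Longrightarrow> y \<le> x \<Longrightarrow> x = y" for x y :: "'a reticulation"
    by (simp add: less_eq_reticulation_def roots_of_inject[symmetric])
  have inf1: "inf x y \<le> x" and inf2: "inf x y \<le> y" for x y :: "'a reticulation"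
    unfolding inf_reticulation_def
    by (metis c mult_le_left mult_le_right reticulate_mono representative(2))+
  show "inf x y \<le> x" "inf x y \<le> y" by (fact inf1 inf2)+
  show infI: "x \<le> y \<Longrightarrow> x \<le> z \<Longrightarrow> x \<le> inf y z" for x y z :: "'a reticulation"
    unfolding inf_reticulation_def by (metis c representative(2) reticulate_le_mult)
  have sup1: "x \<le> sup x y" and sup2: "y \<le> sup x y" for x y :: "'a reticulation"
    unfolding sup_reticulation_def
    by (metis c sup_ge1 sup_ge2 reticulate_mono representative(2))+
  show "x \<le> sup x y" "y \<le> sup x y" by (fact sup1 sup2)+
  show supI: "y \<le> x \<Longrightarrow> z \<le> x \<Longrightarrow> sup y z \<le> x" for x y z :: "'a reticulation"
    unfolding sup_reticulation_def by (metis c representative(2) reticulate_sup_le)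
  show "bot \<le> x" unfolding bot_reticulation_def
    by (metis c bot_least reticulate_mono representative(2))
  show "x \<le> top" unfolding top_reticulation_def
    by (metis c top_greatest reticulate_mono representative(2))
  have trans: "x \<le> y \<Longrightarrow> y \<le> z \<Longrightarrow> x \<le> z" for x y z :: "'a reticulation"
    by (auto simp: less_eq_reticulation_def)
  have sup_eq: "sup (reticulate a) (reticulate b) = reticulate (sup a b)"
    if "compact_element a" "compact_element b" for a b :: 'a
  proof (rule antisym)
    show "sup (reticulate a) (reticulate b) \<le> reticulate (sup a b)"
      using that by (intro supI reticulate_mono compact_element_sup) auto
    show "reticulate (sup a b) \<le> sup (reticulate a) (reticulate b)"
      by (metis that c representative(2) reticulate_sup_le sup1 sup2)
  qed
  have inf_eq: "inf (reticulate a) (reticulate b) = reticulate (a * b)"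
    if "compact_element a" "compact_element b" for a b :: 'a
  proof (rule antisym)
    show "reticulate (a * b) \<le> inf (reticulate a) (reticulate b)"
      using that by (intro infI reticulate_mono compact_mult mult_le_left mult_le_right)
    show "inf (reticulate a) (reticulate b) \<le> reticulate (a * b)"
      by (metis that c representative(2) reticulate_le_mult inf1 inf2)
  qed
  show "sup x (inf y z) = inf (sup x y) (sup x z)"
  proof (rule antisym)
    show "sup x (inf y z) \<le> inf (sup x y) (sup x z)"
      by (intro supI infI sup1) (meson inf1 inf2 sup2 trans)+
    define a b d where abd: "a = representative x" "b = representative y" "d = representative z"
    have k: "compact_element a" "compact_element b" "compact_element d"
      and xyz: "x = reticulate a" "y = reticulate b" "z = reticulate d"
      unfolding abd by (simp_all add: representative)
    have "sup a b * sup a d = sup (sup (a * a) (a * b)) (sup (a * d) (b * d))"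
      by (simp add: mult_sup sup_mult sup.assoc mult.commute sup.left_commute)
    also have "\<dots> \<le> sup a (b * d)"
      by (simp add: mult_le_left mult_le_right le_supI1)
    finally have "reticulate (sup a b * sup a d) \<le> reticulate (sup a (b * d))"
      by (intro reticulate_mono) (simp_all add: k c)
    then show "inf (sup x y) (sup x z) \<le> sup x (inf y z)"
      by (simp add: xyz k c sup_eq inf_eq)
  qed
qed

end

theorem is_reticulation_reticulate:
  "is_reticulation (reticulate :: 'a::coherent_quantale \<Rightarrow> 'a reticulation)"
proof -
  have "x \<in> reticulate ` {a. compact_element a}" for x :: "'a reticulation"
    by (metis imageI mem_Collect_eq representative)
  moreover have "reticulate (sup a b) \<le> sup (reticulate a) (reticulate b)"
    if "compact_element a" "compact_element b" for a b :: 'a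
    by (metis that representative reticulate_sup_le sup_ge1 sup_ge2)
  moreover have "reticulate (a * b) = inf (reticulate a) (reticulate b)"
    if "compact_element a" "compact_element b" for a b :: 'a
  proof (rule order_antisym)
    show "reticulate (a * b) \<le> inf (reticulate a) (reticulate b)"
      using that by (intro le_infI reticulate_mono compact_mult mult_le_left mult_le_right)
    show "inf (reticulate a) (reticulate b) \<le> reticulate (a * b)"
      by (metis that representative reticulate_le_mult inf_le1 inf_le2)
  qed
  ultimately show ?thesis
    unfolding is_reticulation_def by (auto simp: reticulate_le_iff)
qed


section \<open>The Pierce spectrum\<close>

definition regular :: "'a::quantale \<Rightarrow> bool" where
  "regular a \<longleftrightarrow> (\<exists>X\<subseteq>complemented_elements. a = Sup X)"

definition Sp :: "'a::quantale set" where
  "Sp = {p. regular p \<and> p \<noteq> top \<and> (\<forall>x. regular x \<longrightarrow> x \<noteq> top \<longrightarrow> p \<le> x \<longrightarrow> x = p)}"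

definition Sp_basic_open :: "'a::quantale \<Rightarrow> 'a set" where
  "Sp_basic_open e = {p \<in> Sp. \<not> e \<le> p}"

definition Sp_topology :: "'a::quantale topology" where
  "Sp_topology = topology (arbitrary union_of (\<lambda>V. V \<in> Sp_basic_open ` complemented_elements))"

definition s_map :: "'a::quantale \<Rightarrow> 'a" where
  "s_map p = Sup {e \<in> complemented_elements. e \<le> p}"

lemma mult_complements:
  fixes e f e' f' :: "'a::quantale"
  assumes "sup e e' = top" "inf e e' = bot" "sup f f' = top" "inf f f' = bot"
  shows "sup (e * f) (sup e' f') = top" "inf (e * f) (sup e' f') = bot"
proof -
  have "top = sup e e' * sup f f'" using assms by (simp add: mult_top)
  also have "\<dots> = sup (sup (e * f) (f * e')) (sup (e * f') (e' * f'))"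
    by (simp add: mult_sup sup_mult sup.assoc sup.left_commute mult.commute)
  also have "\<dots> \<le> sup (e * f) (sup e' f')"
    by (simp add: le_supI1 le_supI2 le_mult_le)
  finally show *: "sup (e * f) (sup e' f') = top" by (simp add: top_unique)
  have "e * e' = bot" "f * f' = bot"
    using assms mult_le_inf by (metis bot.extremum_uniqueI)+
  then have "e * f * e' = bot" "e * f * f' = bot"
    by (simp_all add: mult.assoc mult_bot) (metis mult.commute mult.left_commute mult_bot)
  then have z: "e * f * sup e' f' = bot" by (simp add: mult_sup)
  let ?x = "inf (e * f) (sup e' f')"
  have "?x = ?x * sup (e * f) (sup e' f')" using * by (simp add: mult_top)
  also have "\<dots> = sup (?x * (e * f)) (?x * sup e' f')" by (rule mult_sup)
  also have "\<dots> \<le> sup (sup e' f' * (e * f)) (e * f * sup e' f')"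
    by (intro sup_mono mult_mono_both) auto
  also have "\<dots> = bot" using z by (simp add: mult.commute)
  finally show "?x = bot" by (simp add: bot_unique)
qed

lemma complemented_mult:
  fixes e f :: "'a::quantale"
  assumes "e \<in> complemented_elements" "f \<in> complemented_elements"
  shows "e * f \<in> complemented_elements"
  using assms mult_complements unfolding complemented_elements_def by fast

lemma Sp_mult_le:
  fixes p e f :: "'a::quantale"
  assumes p: "p \<in> Sp" and e: "e \<in> complemented_elements" and le: "e * f \<le> p"
  shows "e \<le> p \<or> f \<le> p"
proof (rule ccontr)
  assume n: "\<not> (e \<le> p \<or> f \<le> p)"
  obtain X where X: "X \<subseteq> complemented_elements" "p = Sup X"
    using p by (auto simp: Sp_def regular_def)
  have "regular (sup p e)"
    unfolding regular_def by (rule exI[of _ "insert e X"]) (use X e in \<open>simp add: sup.commute\<close>)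
  then have "sup p e = top \<or> sup p e = p" using p by (auto simp: Sp_def)
  moreover have "sup p e \<noteq> p" using n by (simp add: sup.absorb_iff1)
  ultimately have "sup p e = top" by blast
  then have "f = sup (p * f) (e * f)" by (metis sup_mult mult.commute mult_top)
  also have "\<dots> \<le> p" using le by (simp add: mult_le_left)
  finally show False using n by blast
qed

lemma openin_Sp_topology:
  "openin Sp_topology = arbitrary union_of (\<lambda>V. V \<in> Sp_basic_open ` complemented_elements)"
proof -
  have "Sp_basic_open e \<inter> Sp_basic_open f = Sp_basic_open (e * f)"
    if "e \<in> complemented_elements" for e f :: 'a
    using Sp_mult_le[OF _ that] unfolding Sp_basic_open_def
    by (auto dest: le_mult_le)
  then have "istopology (arbitrary union_of
      (\<lambda>V. V \<in> Sp_basic_open ` (complemented_elements :: 'a set)))"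
    by (intro istopology_base) (auto simp: complemented_mult)
  then show ?thesis by (simp add: Sp_topology_def topology_inverse')
qed

lemma topspace_Sp_topology: "topspace Sp_topology = (Sp :: 'a::quantale set)"
proof -
  have "(top :: 'a) \<in> complemented_elements" by (auto simp: complemented_elements_def intro: exI[of _ bot])
  moreover have "Sp_basic_open (top :: 'a) = Sp"
    by (auto simp: Sp_basic_open_def Sp_def top_unique)
  ultimately have "openin Sp_topology (Sp :: 'a set)"
    unfolding openin_Sp_topology by (metis arbitrary_union_of_inc imageI)
  moreover have "topspace Sp_topology \<subseteq> (Sp :: 'a set)"
    unfolding topspace_def openin_Sp_topology union_of_def Sp_basic_open_def by fastforce
  ultimately show ?thesis by (meson openin_subset subset_antisym)
qed

end

theory Submission
  imports Defs
begin

text \<open>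
  For coherent \<open>A\<close>, \<open>B\<close>-normality says that \<open>a \<squnion> b = 1\<close> always yields complementary \<open>e \<le> a\<close> and
  \<open>f \<le> b\<close>. All conditions are compared with this one. Complementary pairs of \<open>R(A)\<close> and
  \<open>L(A)\<close> lift to \<open>A\<close>: if \<open>u \<squnion> v = 1\<close> and \<open>uv\<close> is below the nilradical, then suitable powers of compact
  elements below \<open>u\<close> and \<open>v\<close> are complementary. Condition (4) gives \<open>B\<close>-normality by two applications
  of compactness of \<open>1\<close>. For (5), separate two maximal elements by a clopen set and its
  complement, cut out by \<open>a\<close> and \<open>b\<close>; then \<open>a \<squnion> b = 1\<close>, and the elements \<open>x, y\<close> given by
  normality are complementary because every maximal element is above exactly one of \<open>a, b\<close>.
\<close>

section \<open>Maximal and prime elements\<close>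

lemma finite_chain_Sup_in:
  fixes F :: "'a::complete_lattice set"
  assumes "finite F" "F \<noteq> {}" "\<forall>x\<in>F. \<forall>y\<in>F. x \<le> y \<or> y \<le> x"
  shows "Sup F \<in> F"
  using assms
proof (induction F rule: finite_ne_induct)
  case (singleton x)
  then show ?case by simp
next
  case (insert x F)
  then have "Sup F \<in> F" by blast
  then have "x \<le> Sup F \<or> Sup F \<le> x" using insert.prems by blast
  then show ?case using \<open>Sup F \<in> F\<close> by (auto simp: sup.absorb1 sup.absorb2)
qed

text \<open>Zorn's lemma applies because the elements of \<open>K\<close> are compact: one lying
  below the join of a chain lies below a finite join, hence below a member of the chain. With
  \<open>K = {top}\<close> this produces maximal elements, with \<open>K\<close> the powers of a
  compact element it produces primes.\<close>

lemma exists_maximal_avoiding_compacts: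
  fixes b :: "'a::complete_lattice"
  assumes K: "\<And>k. k \<in> K \<Longrightarrow> compact_element k" and b: "\<And>k. k \<in> K \<Longrightarrow> \<not> k \<le> b"
  obtains p where "b \<le> p" "\<And>k. k \<in> K \<Longrightarrow> \<not> k \<le> p"
    "\<And>x. p \<le> x \<Longrightarrow> x \<noteq> p \<Longrightarrow> \<exists>k\<in>K. k \<le> x"
proof -
  let ?A = "{x. b \<le> x \<and> (\<forall>k\<in>K. \<not> k \<le> x)}"
  have "\<exists>m\<in>?A. \<forall>a\<in>?A. m \<le> a \<longrightarrow> a = m"
  proof (rule predicate_Zorn)
    show "partial_order_on ?A (relation_of (\<le>) ?A)"
      by (rule partial_order_on_relation_ofI) auto
    fix C assume "C \<in> Chains (relation_of (\<le>) ?A)"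
    then have CA: "C \<subseteq> ?A" and chain: "\<forall>x\<in>C. \<forall>y\<in>C. x \<le> y \<or> y \<le> x"
      by (auto simp: Chains_def relation_of_def)
    show "\<exists>u\<in>?A. \<forall>a\<in>C. a \<le> u"
    proof (cases "C = {}")
      case True
      then show ?thesis using b by blast
    next
      case False
      have "b \<le> Sup C" using False CA by (metis (mono_tags, lifting) Sup_upper2 all_not_in_conv mem_Collect_eq subsetD)
      moreover have "\<not> k \<le> Sup C" if k: "k \<in> K" for k
      proof
        assume "k \<le> Sup C"
        then obtain F where F: "F \<subseteq> C" "finite F" "k \<le> Sup F"
          using K[OF k] unfolding compact_element_def by blast
        obtain c where c: "c \<in> C" using False by blast
        \<comment> \<open>The finite subset \<open>F\<close> may be empty, so a member
          \<open>c\<close> of the chain is added before taking the largest element.\<close>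
        have "Sup (insert c F) \<in> insert c F"
          using F c chain by (intro finite_chain_Sup_in) auto
        moreover have "insert c F \<subseteq> C" using F c by simp
        ultimately have "Sup (insert c F) \<in> C" by (rule subsetD[rotated])
        moreover have "k \<le> Sup (insert c F)" using F(3) by (simp add: le_supI2)
        ultimately show False using CA k by blast
      qed
      ultimately show ?thesis by (auto intro: Sup_upper)
    qed
  qed
  then show ?thesis using that by (smt (verit, best) mem_Collect_eq order_trans)
qed

lemma exists_Max_Spec_above:
  fixes x :: "'a::coherent_quantale"
  assumes "x \<noteq> top"
  obtains m where "m \<in> Max_Spec" "x \<le> m"
proof -
  obtain p where "x \<le> p" "\<not> top \<le> p" "\<And>y. p \<le> y \<Longrightarrow> y \<noteq> p \<Longrightarrow> top \<le> y"
    using exists_maximal_avoiding_compacts[of "{top}" x] assms compact_top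
    by (auto simp: top_unique)
  then show ?thesis using that unfolding Max_Spec_def by (auto simp: top_unique)
qed

text \<open>A join different from \<open>top\<close> lies below some maximal element. Many later
  proofs that a join is \<open>top\<close> check this one maximal element at a time.\<close>

lemma sup_top_iff_Max_Spec:
  fixes a b :: "'a::coherent_quantale"
  shows "sup a b = top \<longleftrightarrow> (\<forall>m\<in>Max_Spec. \<not> (a \<le> m \<and> b \<le> m))"
proof
  assume "sup a b = top"
  then show "\<forall>m\<in>Max_Spec. \<not> (a \<le> m \<and> b \<le> m)"
    unfolding Max_Spec_def by (metis (mono_tags, lifting) le_sup_iff mem_Collect_eq top_unique)
next
  assume "\<forall>m\<in>Max_Spec. \<not> (a \<le> m \<and> b \<le> m)"
  then show "sup a b = top" using exists_Max_Spec_above[of "sup a b"] by (metis le_sup_iff)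
qed

lemma Max_Spec_Spec: "m \<in> Max_Spec \<Longrightarrow> m \<in> Spec"
  using Max_Spec_subset_Spec by blast

text \<open>Maximal elements are prime, so \<open>b\<close> and \<open>rho b\<close> lie below the
  same ones.\<close>

lemma sup_rho_top_iff:
  fixes a b :: "'a::coherent_quantale"
  shows "sup a (rho b) = top \<longleftrightarrow> sup a b = top" "sup (rho a) b = top \<longleftrightarrow> sup a b = top"
  by (auto simp: sup_top_iff_Max_Spec rho_le_iff_prime Max_Spec_Spec)

lemma rho_top_iff:
  fixes a :: "'a::coherent_quantale"
  shows "rho a = top \<longleftrightarrow> a = top"
  using sup_rho_top_iff(1)[of bot a] by simp

section \<open>Radicals of compact elements described by powers\<close>

lemma compact_power:
  fixes a :: "'a::coherent_quantale"
  shows "compact_element a \<Longrightarrow> compact_element (a ^ n)"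
  by (induction n) (simp_all add: one_eq_top compact_top compact_mult)

lemma Spec_power_le:
  fixes p :: "'a::quantale"
  shows "p \<in> Spec \<Longrightarrow> a ^ n \<le> p \<Longrightarrow> a \<le> p"
proof (induction n)
  case 0
  then show ?case by (simp add: one_eq_top top_unique Spec_def)
next
  case (Suc n)
  then show ?case by (auto simp: Spec_mult_le_iff)
qed

text \<open>This is the analogue of the description of the radical of an ideal by powers. If no
  power of \<open>a\<close> is below \<open>b\<close>, an element above \<open>b\<close> that is
  maximal among those avoiding all powers of \<open>a\<close> is prime, and it is not above
  \<open>a\<close>. The exponent 0 is harmless: it forces \<open>b = top\<close>.\<close>

lemma compact_le_rho_iff:
  fixes a b :: "'a::coherent_quantale"
  assumes "compact_element a"
  shows "a \<le> rho b \<longleftrightarrow> (\<exists>n. a ^ n \<le> b)"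
proof
  assume "\<exists>n. a ^ n \<le> b"
  then show "a \<le> rho b" unfolding le_rho_iff by (meson Spec_power_le order_trans)
next
  assume le: "a \<le> rho b"
  show "\<exists>n. a ^ n \<le> b"
  proof (rule ccontr)
    assume "\<nexists>n. a ^ n \<le> b"
    then obtain p where p: "b \<le> p" "\<And>k. k \<in> range ((^) a) \<Longrightarrow> \<not> k \<le> p"
      "\<And>x. p \<le> x \<Longrightarrow> x \<noteq> p \<Longrightarrow> \<exists>k\<in>range ((^) a). k \<le> x"
      using exists_maximal_avoiding_compacts[of "range ((^) a)" b] compact_power[OF assms]
      by (smt (verit) imageE)
    have avoid: "\<not> a ^ n \<le> p" for n using p(2) by blast
    have above: "\<exists>n. a ^ n \<le> sup p x" if "\<not> x \<le> p" for x
    proof -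
      have "sup p x \<noteq> p" using that by (simp add: sup.absorb_iff1)
      then show ?thesis using p(3)[OF sup_ge1] by blast
    qed
    \<comment> \<open>As with ideals maximal with respect to avoiding a multiplicative set: if both
      factors failed, the joins \<open>sup p x\<close> and \<open>sup p y\<close> would contain
      powers of \<open>a\<close>, and the product of these powers would lie below
      \<open>p\<close>.\<close>
    have "x \<le> p \<or> y \<le> p" if xy: "x * y \<le> p" for x y
    proof (rule ccontr)
      assume "\<not> (x \<le> p \<or> y \<le> p)"
      then obtain n m where "a ^ n \<le> sup p x" "a ^ m \<le> sup p y" using above by blast
      then have "a ^ (n + m) \<le> sup p x * sup p y" by (simp add: power_add mult_mono_both)
      also have "\<dots> \<le> p" using xy by (simp add: mult_sup sup_mult le_mult_le)
      finally show False using avoid by blast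
    qed
    moreover have "p \<noteq> top" using avoid[of 0] by auto
    ultimately have "p \<in> Spec" by (simp add: Spec_def top.not_eq_extremum)
    then have "a \<le> p" using le p(1) by (auto simp: le_rho_iff)
    then show False using avoid[of 1] by simp
  qed
qed

lemma sup_power_top:
  fixes a b :: "'a::coherent_quantale"
  shows "sup a b = top \<Longrightarrow> sup (a ^ n) (b ^ m) = top"
  unfolding sup_top_iff_Max_Spec using Spec_power_le Max_Spec_Spec by blast

text \<open>Compactness of \<open>top\<close> leaves finitely many members of \<open>X\<close>, and
  closure under binary joins merges them into one. It is applied to the compact and to the
  complemented elements below a given element.\<close>

lemma sup_directed_Sup_top:
  fixes a :: "'a::coherent_quantale"
  assumes top: "sup a (Sup X) = top" and X: "bot \<in> X" "\<And>x y. x \<in> X \<Longrightarrow> y \<in> X \<Longrightarrow> sup x y \<in> X"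
  obtains x where "x \<in> X" "sup a x = top"
proof -
  have "Sup (sup a ` X) = top"
  proof (rule top_le[OF order_trans])
    show "top \<le> sup a (Sup X)" using top by simp
    show "sup a (Sup X) \<le> Sup (sup a ` X)"
      \<comment> \<open>The member \<open>bot\<close> of \<open>X\<close> puts \<open>a\<close>
        itself below the join; for empty \<open>X\<close> this would fail.\<close>
      using X(1) by (auto intro!: Sup_least intro: SUP_upper2)
  qed
  then obtain F where F: "F \<subseteq> sup a ` X" "finite F" "Sup F = top"
    using compact_top unfolding compact_element_def by (metis top_greatest top_unique)
  have "\<exists>x\<in>X. Sup F \<le> sup a x" using F(2,1)
  proof (induction F)
    case empty
    then show ?case using X(1) by auto
  next
    case (insert y F)
    then obtain x z where "x \<in> X" "Sup F \<le> sup a x" "z \<in> X" "y = sup a z" by blast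
    then show ?case by (intro bexI[of _ "sup z x"]) (auto simp: X le_supI1 le_supI2 intro: order_trans)
  qed
  then show ?thesis using that F(3) by (metis top_unique)
qed

text \<open>By coherence each element is the join of the directed set of compact elements below it,
  so either side of a join equal to \<open>top\<close> can be shrunk to a compact element.\<close>

lemma compact_below_sup_top:
  fixes a b :: "'a::coherent_quantale"
  assumes "sup a b = top"
  obtains c d where "compact_element c" "c \<le> a" "compact_element d" "d \<le> b" "sup c d = top"
proof -
  have below: "\<exists>c. compact_element c \<and> c \<le> y \<and> sup x c = top" if "sup x y = top" for x y :: 'a
  proof -
    obtain X where X: "\<forall>c\<in>X. compact_element c" "y = Sup X" using join_of_compact by blast
    have "Sup X \<le> Sup {c. compact_element c \<and> c \<le> y}"
      using X by (intro Sup_subset_mono) (auto intro: Sup_upper)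
    then have "y \<le> Sup {c. compact_element c \<and> c \<le> y}" using X(2) by simp
    moreover have "Sup {c. compact_element c \<and> c \<le> y} \<le> y" by (rule Sup_least) simp
    ultimately have "y = Sup {c. compact_element c \<and> c \<le> y}" by (rule order_antisym)
    then have "sup x (Sup {c. compact_element c \<and> c \<le> y}) = top" using that by simp
    then obtain c where "c \<in> {c. compact_element c \<and> c \<le> y}" "sup x c = top"
      by (rule sup_directed_Sup_top) (auto simp: compact_element_bot compact_element_sup)
    then show ?thesis by blast
  qed
  obtain d where "compact_element d" "d \<le> b" "sup a d = top" using below[OF assms] by blast
  \<comment> \<open>The second reduction starts from the already shrunk \<open>d\<close>, so that
    both compact elements work together.\<close>
  moreover obtain c where "compact_element c" "c \<le> a" "sup d c = top"
    using below[of d a] \<open>sup a d = top\<close> by (auto simp: sup.commute)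
  ultimately show ?thesis using that by (simp add: sup.commute)
qed


section \<open>Complementary pairs\<close>

lemma bot_mult: "bot * a = (bot::'a::quantale)"
  using mult_bot[of a] by (simp add: mult.commute)

text \<open>Stated with the product in place of the meet because products combine directly with
  primes and powers; the next lemma shows that the two versions agree.\<close>

definition complementary :: "'a::quantale \<Rightarrow> 'a \<Rightarrow> bool" where
  "complementary e f \<longleftrightarrow> sup e f = top \<and> e * f = bot"

text \<open>Multiplying the meet by \<open>sup e f = top\<close> splits it into two products, each
  below \<open>e * f\<close>.\<close>

lemma complementary_iff_inf: "complementary e f \<longleftrightarrow> sup e f = top \<and> inf e f = bot"
proof -
  have "inf e f \<le> e * f" if "sup e f = top"
  proof -
    have "inf e f = sup (inf e f * e) (inf e f * f)"
      using that by (metis mult_sup mult_top)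
    also have "\<dots> \<le> e * f"
      by (metis inf.cobounded1 inf.cobounded2 le_sup_iff mult.commute mult_mono_both order_refl)
    finally show ?thesis .
  qed
  then show ?thesis
    unfolding complementary_def by (metis bot.extremum_uniqueI mult_le_inf)
qed

lemma complementary_sym: "complementary e f \<Longrightarrow> complementary f e"
  by (simp add: complementary_def sup.commute mult.commute)

lemma complemented_elements_iff: "e \<in> complemented_elements \<longleftrightarrow> (\<exists>f. complementary e f)"
  by (simp add: complemented_elements_def complementary_iff_inf)

lemma complementary_imp_complemented:
  assumes "complementary e f"
  shows "e \<in> complemented_elements" "f \<in> complemented_elements"
  using assms complementary_sym by (auto simp: complemented_elements_iff)

lemma complementary_complement: "complementary e f \<Longrightarrow> complement e = f"
  by (simp add: complement_eqI complementary_iff_inf)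

text \<open>Multiplying \<open>sup a f = top\<close> by \<open>e\<close> removes the part from
  \<open>f\<close> and leaves \<open>e = e * a\<close>. This translates between the joins in the
  definition of \<open>B_normal\<close> and order relations.\<close>

lemma complementary_le_iff: "complementary e f \<Longrightarrow> e \<le> a \<longleftrightarrow> sup a f = top"
proof
  assume ef: "complementary e f" and "sup a f = top"
  then have "e = sup (e * a) (e * f)" by (metis mult_sup mult_top)
  then show "e \<le> a" using ef by (metis complementary_def mult_le_right sup_bot_right)
next
  assume "complementary e f" and "e \<le> a"
  then show "sup a f = top" by (metis complementary_def sup.mono order_refl top_le)
qed

lemma complementary_prime_le: "complementary e f \<Longrightarrow> p \<in> Spec \<Longrightarrow> e \<le> p \<longleftrightarrow> \<not> f \<le> p"
proof -
  assume ef: "complementary e f" and p: "p \<in> Spec"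
  have "e * f \<le> p" using ef by (simp add: complementary_def)
  then have "e \<le> p \<or> f \<le> p" using Spec_mult_le_iff[OF p] by blast
  moreover have "\<not> (e \<le> p \<and> f \<le> p)"
  proof
    assume "e \<le> p \<and> f \<le> p"
    then have "sup e f \<le> p" by (simp only: le_sup_iff)
    moreover have "sup e f = top" using ef complementary_def by blast
    ultimately have "p = top" by (simp only: top_unique)
    then show False using p by (simp add: Spec_def)
  qed
  ultimately show ?thesis by blast
qed

text \<open>The complement of \<open>e\<close> is thus the largest annihilator of \<open>e\<close>,
  so the second element supplied by B-normality can be enlarged to the complement of the
  first.\<close>

lemma complementary_annihilator:
  assumes "complementary e e'" "e * f = bot"
  shows "f \<le> e'"
proof -
  have "f = f * sup e e'" using assms(1) by (simp add: complementary_def mult_top)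
  also have "\<dots> = f * e'" using assms(2) by (simp add: mult_sup mult.commute[of f e])
  finally show ?thesis by (metis mult_le_right)
qed

lemma complemented_bot: "(bot::'a::quantale) \<in> complemented_elements"
  by (auto simp: complemented_elements_iff complementary_def mult_bot mult.commute intro!: exI[of _ top])

lemma complemented_sup:
  fixes e f :: "'a::quantale"
  assumes "e \<in> complemented_elements" "f \<in> complemented_elements"
  shows "sup e f \<in> complemented_elements"
proof -
  obtain e' f' where "sup e e' = top" "inf e e' = bot" "sup f f' = top" "inf f f' = bot"
    using assms by (auto simp: complemented_elements_def)
  then have "sup (sup e f) (e' * f') = top" "inf (sup e f) (e' * f') = bot"
    using mult_complements[of e' e f' f] by (simp_all add: sup.commute inf.commute)
  then show ?thesis unfolding complemented_elements_def by blast
qed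

text \<open>Compact \<open>c\<close> and \<open>d\<close> below \<open>e\<close> and
  \<open>f\<close> still join to \<open>top\<close>, which forces \<open>e \<le> c\<close> and hence
  \<open>e = c\<close>. This makes the reticulation map available on complemented elements.\<close>

lemma complementary_compact:
  fixes e f :: "'a::coherent_quantale"
  assumes "complementary e f"
  shows "compact_element e"
proof -
  obtain c d where c: "compact_element c" "c \<le> e" "d \<le> f" "sup c d = top"
    using assms unfolding complementary_def by (metis compact_below_sup_top)
  then have "sup c f = top" by (metis order_refl sup.mono top_le)
  then have "e \<le> c" using assms complementary_le_iff by blast
  then show ?thesis using c by (simp add: order_antisym)
qed

lemma B_normal_iff_complementary:
  "B_normal TYPE('a::coherent_quantale) \<longleftrightarrow>
    (\<forall>a b :: 'a. sup a b = top \<longrightarrow> (\<exists>e f. complementary e f \<and> e \<le> a \<and> f \<le> b))"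
  (is "_ \<longleftrightarrow> ?N")
proof
  assume B: "B_normal TYPE('a)"
  show ?N
  proof (intro allI impI)
    fix a b :: 'a assume "sup a b = top"
    then obtain c d where cd: "compact_element c" "c \<le> a" "compact_element d" "d \<le> b" "sup c d = top"
      by (rule compact_below_sup_top)
    then obtain e f where ef: "e \<in> complemented_elements"
      "sup c e = top" "sup d f = top" "e * f = bot"
      using B unfolding B_normal_def by blast
    obtain e' where e': "complementary e e'" using ef(1) complemented_elements_iff by blast
    have "f \<le> e'" using complementary_annihilator[OF e' ef(4)] .
    then have "sup d e' = top" using ef(3) by (metis order_refl sup.mono top_le)
    \<comment> \<open>The roles cross over: \<open>e\<close> joins with \<open>c\<close> to
      \<open>top\<close>, so it is the complement \<open>e'\<close> that lies below
      \<open>c\<close>.\<close>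
    then have "e \<le> d" "e' \<le> c"
      using ef(2) e' complementary_le_iff complementary_sym by blast+
    then show "\<exists>e f. complementary e f \<and> e \<le> a \<and> f \<le> b"
      using e' cd complementary_sym order_trans by blast
  qed
next
  assume N: ?N
  show "B_normal TYPE('a)"
    unfolding B_normal_def
  proof (intro allI impI)
    fix c d :: 'a assume "sup c d = top"
    then obtain e f where ef: "complementary e f" "e \<le> c" "f \<le> d" using N by blast
    then have "sup c f = top" "sup d e = top" "f * e = bot"
      using complementary_le_iff complementary_sym complementary_def by blast+
    then show "\<exists>e\<in>complemented_elements. \<exists>f\<in>complemented_elements.
        sup c e = top \<and> sup d f = top \<and> e * f = bot"
      using complementary_imp_complemented[OF ef(1)] by blast
  qed
qed

text \<open>Complementation modulo the nilradical \<open>rho bot\<close> becomes exact after passing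
  to compact elements and then to powers; powers do not disturb a join equal to
  \<open>top\<close>.\<close>

lemma complementary_lift:
  fixes a b u v :: "'a::coherent_quantale"
  assumes "sup u v = top" "u * v \<le> rho bot" "u \<le> rho a" "v \<le> rho b"
  shows "\<exists>e f. complementary e f \<and> e \<le> a \<and> f \<le> b"
proof -
  obtain c d where cd: "compact_element c" "c \<le> u" "compact_element d" "d \<le> v" "sup c d = top"
    using compact_below_sup_top[OF assms(1)] by blast
  have "c * d \<le> rho bot" using cd assms(2) mult_mono_both order_trans by blast
  then obtain n where n: "(c * d) ^ n \<le> bot"
    using compact_le_rho_iff compact_mult cd by blast
  obtain k where k: "c ^ k \<le> a" using compact_le_rho_iff cd assms order_trans by metis
  obtain l where l: "d ^ l \<le> b" using compact_le_rho_iff cd assms order_trans by metis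
  \<comment> \<open>The common summand \<open>n\<close> makes the product vanish, while
    \<open>k\<close> and \<open>l\<close> bring the two powers below \<open>a\<close> and
    \<open>b\<close>.\<close>
  let ?e = "c ^ (n + k)" and ?f = "d ^ (n + l)"
  have "?e * ?f = (c * d) ^ n * (c ^ k * d ^ l)"
    by (simp add: power_add power_mult_distrib ac_simps)
  also have "\<dots> = bot" using n by (simp add: bot_unique bot_mult)
  finally have "complementary ?e ?f" using sup_power_top[OF cd(5)] by (simp add: complementary_def)
  moreover have "?e \<le> a" "?f \<le> b" using k l by (simp_all add: power_add le_mult_le)
  ultimately show ?thesis by blast
qed


section \<open>The radical frame and the reticulation\<close>

text \<open>A cover of \<open>rho a\<close> in the radical frame covers some power of
  \<open>a\<close> in the quantale. That power is compact, and a finite subcover of it has radical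
  above \<open>a\<close>.\<close>

lemma compact_radical:
  fixes a :: "'a::coherent_quantale"
  assumes "compact_element a"
  shows "compact_element (Abs_radical (rho a))"
  unfolding compact_element_def
proof (intro allI impI)
  fix X :: "'a radical set"
  assume "Abs_radical (rho a) \<le> Sup X"
  then have "a \<le> rho (Sup (of_radical ` X))"
    using le_rho order_trans by (auto simp: less_eq_radical_def of_radical_Abs_rho of_radical_Sup)
  then obtain n where "a ^ n \<le> Sup (of_radical ` X)" using compact_le_rho_iff assms by blast
  then obtain F where F: "F \<subseteq> of_radical ` X" "finite F" "a ^ n \<le> Sup F"
    using compact_power[OF assms, of n] unfolding compact_element_def by blast
  obtain G where G: "G \<subseteq> X" "finite G" "F = of_radical ` G"
    using F finite_subset_image by metis
  have "a \<le> rho (Sup (of_radical ` G))" using F G compact_le_rho_iff assms by blast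
  then have "Abs_radical (rho a) \<le> Sup G"
    by (metis less_eq_radical_def of_radical_Abs_rho of_radical_Sup rho_idem rho_mono)
  then show "\<exists>F\<subseteq>X. finite F \<and> Abs_radical (rho a) \<le> Sup F" using G by blast
qed

lemma of_radical_sup_top_iff:
  fixes x y :: "'a::coherent_quantale radical"
  shows "sup x y = top \<longleftrightarrow> sup (of_radical x) (of_radical y) = top"
  by (simp add: of_radical_inject[symmetric] of_radical_sup of_radical_top rho_top_iff)

text \<open>Radicals of a complementary pair are complementary, since each prime is above one of
  them. Conversely, a complementary pair of the radical frame is complementary modulo
  \<open>rho bot\<close> in the quantale, and \<open>complementary_lift\<close> applies.\<close>

lemma B_normal_radical_iff:
  "B_normal TYPE('a::coherent_quantale) \<longleftrightarrow> B_normal_frame TYPE('a radical)"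
proof
  assume B: "B_normal TYPE('a)"
  show "B_normal_frame TYPE('a radical)"
    unfolding B_normal_frame_def B_normal_def
  proof (intro allI impI)
    fix c d :: "'a radical" assume "sup c d = top"
    then obtain e f where ef: "complementary e f" "e \<le> of_radical c" "f \<le> of_radical d"
      using B unfolding B_normal_iff_complementary of_radical_sup_top_iff by blast
    let ?e = "Abs_radical (rho e)" and ?f = "Abs_radical (rho f)"
    have "rho e \<le> p \<or> rho f \<le> p" if "p \<in> Spec" for p
      using complementary_prime_le[OF ef(1) that] rho_le_iff_prime[OF that] by blast
    then have "inf (rho e) (rho f) \<le> rho bot"
      unfolding le_rho_iff by (meson inf.coboundedI1 inf.coboundedI2)
    then have inf: "inf ?e ?f = bot"
      by (intro order_antisym) (auto simp: less_eq_radical_def of_radical_inf of_radical_Abs_rho of_radical_bot rho_mono)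
    have "sup ?e ?f = top"
      using ef(1) by (simp add: of_radical_sup_top_iff of_radical_Abs_rho sup_rho_top_iff complementary_def)
    then have *: "complementary ?e ?f" using inf by (simp add: complementary_iff_inf)
    have "?e \<le> c" "?f \<le> d"
      using ef by (simp_all add: less_eq_radical_def of_radical_Abs_rho rho_le_of_radical)
    then have "sup c ?f = top" "sup d ?e = top" "?f * ?e = bot"
      using * complementary_le_iff complementary_sym complementary_def by blast+
    then show "\<exists>e\<in>complemented_elements. \<exists>f\<in>complemented_elements.
        sup c e = top \<and> sup d f = top \<and> e * f = bot"
      using complementary_imp_complemented[OF *] by blast
  qed
next
  assume B: "B_normal_frame TYPE('a radical)"
  show "B_normal TYPE('a)"
    unfolding B_normal_iff_complementary
  proof (intro allI impI)
    fix a' b' :: 'a assume "sup a' b' = top"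
    then obtain a b where ab: "compact_element a" "a \<le> a'" "compact_element b" "b \<le> b'" "sup a b = top"
      by (rule compact_below_sup_top)
    let ?a = "Abs_radical (rho a)" and ?b = "Abs_radical (rho b)"
    have "sup ?a ?b = top"
      using ab by (simp add: of_radical_sup_top_iff of_radical_Abs_rho sup_rho_top_iff)
    then obtain e f where ef: "e \<in> complemented_elements"
      "sup ?a e = top" "sup ?b f = top" "e * f = bot"
      using B compact_radical ab unfolding B_normal_frame_def B_normal_def by blast
    obtain e' where e': "complementary e e'" using ef(1) complemented_elements_iff by blast
    have "f \<le> e'" using complementary_annihilator[OF e' ef(4)] .
    then have "sup ?b e' = top" using ef(3) by (metis order_refl sup.mono top_le)
    then have "e \<le> ?b" "e' \<le> ?a"
      using ef(2) e' complementary_le_iff complementary_sym by blast+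
    then have le: "of_radical e' \<le> rho a" "of_radical e \<le> rho b"
      by (simp_all add: less_eq_radical_def of_radical_Abs_rho)
    have "sup (of_radical e') (of_radical e) = top"
      using e' by (simp add: complementary_def sup.commute flip: of_radical_sup_top_iff)
    \<comment> \<open>The bottom of the radical frame is \<open>rho bot\<close>, and products of the
      quantale lie below meets.\<close>
    moreover have "of_radical e' * of_radical e \<le> rho bot"
    proof -
      have "inf (of_radical e') (of_radical e) = rho bot"
        using e' by (metis complementary_iff_inf inf.commute of_radical_bot of_radical_inf)
      then show ?thesis by (metis mult_le_inf)
    qed
    ultimately have "\<exists>e f. complementary e f \<and> e \<le> a \<and> f \<le> b"
      using le by (rule complementary_lift)
    then show "\<exists>e f. complementary e f \<and> e \<le> a' \<and> f \<le> b'" using ab order_trans by blast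
  qed
qed

section \<open>Transfer of complementary pairs along a reticulation\<close>

context
  fixes lam :: "'a::coherent_quantale \<Rightarrow> 'l::{distrib_lattice,bounded_lattice}"
  assumes ret: "is_reticulation lam"
begin

lemma reticulation_obtain: obtains a where "compact_element a" "x = lam a"
  using ret unfolding is_reticulation_def by (metis UNIV_I imageE mem_Collect_eq)

lemma reticulation_mult: "compact_element a \<Longrightarrow> compact_element b \<Longrightarrow> lam (a * b) = inf (lam a) (lam b)"
  using ret by (simp add: is_reticulation_def)

lemma reticulation_le_iff:
  "compact_element a \<Longrightarrow> compact_element b \<Longrightarrow> lam a \<le> lam b \<longleftrightarrow> (\<exists>n\<ge>1. a ^ n \<le> b)"
  using ret by (simp add: is_reticulation_def)

lemma reticulation_le_imp_le_rho:
  "compact_element a \<Longrightarrow> compact_element b \<Longrightarrow> lam a \<le> lam b \<Longrightarrow> a \<le> rho b"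
  using reticulation_le_iff compact_le_rho_iff by blast

lemma reticulation_mono:
  "compact_element a \<Longrightarrow> compact_element b \<Longrightarrow> a \<le> b \<Longrightarrow> lam a \<le> lam b"
  using reticulation_le_iff by (metis le_refl power_one_right)

lemma reticulation_sup:
  "compact_element a \<Longrightarrow> compact_element b \<Longrightarrow> lam (sup a b) = sup (lam a) (lam b)"
  using ret unfolding is_reticulation_def
  by (intro order_antisym) (auto intro!: reticulation_mono compact_element_sup)

lemma reticulation_top: "lam top = top"
  using reticulation_obtain[of top] reticulation_mono compact_top by (metis top_greatest top_unique)

lemma reticulation_bot: "lam bot = bot"
  using reticulation_obtain[of bot] reticulation_mono compact_element_bot by (metis bot_least bot_unique)

lemma reticulation_eq_top_iff: "compact_element a \<Longrightarrow> lam a = top \<longleftrightarrow> a = top"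
  using reticulation_le_imp_le_rho[of top a] reticulation_top compact_top
  by (metis order_refl rho_top_iff top_unique)

text \<open>Complementary pairs are compact and \<open>lam\<close> preserves joins, products and
  bounds, so it maps them to complementary pairs. Conversely, compact preimages of a complementary
  pair join to \<open>top\<close> and have product below the nilradical, so
  \<open>complementary_lift\<close> applies.\<close>

lemma B_normal_reticulation_iff: "B_normal TYPE('a) \<longleftrightarrow> B_normal_lattice TYPE('l)"
proof
  assume B: "B_normal TYPE('a)"
  show "B_normal_lattice TYPE('l)"
    unfolding B_normal_lattice_def
  proof (intro allI impI)
    fix x y :: 'l assume xy: "sup x y = top"
    obtain a b where ab: "compact_element a" "compact_element b" "x = lam a" "y = lam b"
      using reticulation_obtain by metis
    then have "sup a b = top"
      using xy by (metis compact_element_sup reticulation_eq_top_iff reticulation_sup)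
    then obtain e f where ef: "complementary e f" "e \<le> a" "f \<le> b"
      using B unfolding B_normal_iff_complementary by blast
    have k: "compact_element e" "compact_element f"
      using ef complementary_compact complementary_sym by blast+
    have s: "sup (lam e) (lam f) = top" "sup (lam f) (lam e) = top"
      using reticulation_sup[OF k] ef(1) reticulation_top
      by (simp_all add: complementary_def sup.commute)
    have i: "inf (lam e) (lam f) = bot" "inf (lam f) (lam e) = bot"
      using reticulation_mult[OF k] ef(1) reticulation_bot
      by (simp_all add: complementary_def inf.commute)
    have le: "lam e \<le> x" "lam f \<le> y" using ef k ab reticulation_mono by blast+
    have "sup x (lam f) = top" using sup_mono[OF le(1) order_refl, of "lam f"] s(1) top_le by simp
    moreover have "sup y (lam e) = top" using sup_mono[OF le(2) order_refl, of "lam e"] s(2) top_le by simp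
    moreover have "lam e \<in> complemented_elements" "lam f \<in> complemented_elements"
      using s i unfolding complemented_elements_def by blast+
    moreover note i(2)
    ultimately show "\<exists>e\<in>complemented_elements. \<exists>f\<in>complemented_elements.
        sup x e = top \<and> sup y f = top \<and> inf e f = bot" by blast
  qed
next
  assume B: "B_normal_lattice TYPE('l)"
  show "B_normal TYPE('a)"
    unfolding B_normal_iff_complementary
  proof (intro allI impI)
    fix a' b' :: 'a assume "sup a' b' = top"
    then obtain a b where ab: "compact_element a" "a \<le> a'" "compact_element b" "b \<le> b'" "sup a b = top"
      by (rule compact_below_sup_top)
    then have "sup (lam a) (lam b) = top" by (metis reticulation_sup reticulation_top)
    then obtain e f e' where ef: "sup e e' = top" "inf e e' = bot"
      "sup (lam a) e = top" "sup (lam b) f = top" "inf e f = bot"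
      using B unfolding B_normal_lattice_def complemented_elements_def by blast
    \<comment> \<open>Distributivity gives \<open>e = inf e (sup (lam b) f) = inf e (lam b)\<close>;
      the next line treats \<open>e'\<close> in the same way, with \<open>lam a\<close> and
      \<open>e\<close>.\<close>
    have "e \<le> lam b" by (metis ef(4,5) inf.absorb_iff1 inf_sup_distrib1 inf_top_right sup_bot_right)
    have "e' \<le> lam a" by (metis ef(2,3) inf.absorb_iff1 inf.commute inf_sup_distrib1 inf_top_right sup_bot_right)
    obtain u v where uv: "compact_element u" "compact_element v" "e' = lam u" "e = lam v"
      using reticulation_obtain by metis
    have "sup u v = top"
      using ef(1) uv by (metis compact_element_sup reticulation_eq_top_iff reticulation_sup sup.commute)
    moreover have "u * v \<le> rho bot"
      using ef(2) uv compact_mult compact_element_bot reticulation_bot reticulation_le_imp_le_rho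
        reticulation_mult by (metis inf.commute order_refl)
    moreover have "u \<le> rho a" "v \<le> rho b"
      using \<open>e' \<le> lam a\<close> \<open>e \<le> lam b\<close> uv ab reticulation_le_imp_le_rho by blast+
    ultimately have "\<exists>e f. complementary e f \<and> e \<le> a \<and> f \<le> b" by (rule complementary_lift)
    then show "\<exists>e f. complementary e f \<and> e \<le> a' \<and> f \<le> b'" using ab order_trans by blast
  qed
qed

end


section \<open>Separation of maximal elements\<close>

lemma Max_Spec_sup_top:
  assumes "p \<in> Max_Spec" "\<not> a \<le> p"
  shows "sup p a = top"
proof (rule ccontr)
  assume "sup p a \<noteq> top"
  then have "sup p a = p" using assms(1) by (simp add: Max_Spec_def)
  then show False using assms(2) by (simp add: sup.absorb_iff1)
qed

lemma Max_Spec_distinct_not_le: "p \<in> Max_Spec \<Longrightarrow> q \<in> Max_Spec \<Longrightarrow> p \<noteq> q \<Longrightarrow> \<not> q \<le> p"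
  unfolding Max_Spec_def by blast

text \<open>The complemented elements below \<open>x\<close> are closed under joins, so a single one
  of them already joins with \<open>a\<close> to \<open>top\<close>; its complement is then below
  \<open>a\<close>. Here \<open>s_map\<close> is applied to an arbitrary element, not only to
  primes.\<close>

lemma sup_s_map_top:
  fixes a x :: "'a::coherent_quantale"
  assumes "sup a (s_map x) = top"
  obtains e f where "complementary e f" "e \<le> x" "f \<le> a"
proof -
  have "sup a (Sup {e \<in> complemented_elements. e \<le> x}) = top" using assms by (simp add: s_map_def)
  then obtain e where "e \<in> {e \<in> complemented_elements. e \<le> x}" "sup a e = top"
    by (rule sup_directed_Sup_top) (auto simp: complemented_bot complemented_sup)
  then obtain f where ef: "complementary e f" "e \<le> x" using complemented_elements_iff by blast
  then have "f \<le> a" using complementary_le_iff[OF complementary_sym[OF ef(1)]] \<open>sup a e = top\<close> by blast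
  then show ?thesis using that ef by blast
qed

lemma complementary_le_s_map: "complementary e f \<Longrightarrow> e \<le> s_map x \<longleftrightarrow> e \<le> x"
proof -
  assume "complementary e f"
  then have "e \<le> x \<Longrightarrow> e \<le> s_map x"
    unfolding s_map_def using complementary_imp_complemented by (auto intro: Sup_upper)
  moreover have "s_map x \<le> x" unfolding s_map_def by (auto intro: Sup_least)
  ultimately show ?thesis using order_trans by blast
qed

text \<open>Distinct maximal elements join to \<open>top\<close>, which gives one direction. For the
  other, pairwise separation is improved in two rounds, first replacing one maximal element by
  \<open>a\<close>, then the other by \<open>b\<close>, each time through
  \<open>sup_s_map_top\<close>.\<close>

lemma B_normal_iff_separated:
  "B_normal TYPE('a::coherent_quantale) \<longleftrightarrow>
    (\<forall>p\<in>Max_Spec. \<forall>q\<in>Max_Spec. p \<noteq> q \<longrightarrow> (\<exists>e f :: 'a. complementary e f \<and> e \<le> p \<and> f \<le> q))"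
  (is "_ \<longleftrightarrow> ?S")
proof
  assume "B_normal TYPE('a)"
  then show ?S
    unfolding B_normal_iff_complementary
    using Max_Spec_sup_top Max_Spec_distinct_not_le by blast
next
  assume S: ?S
  have separate: "\<exists>e f. complementary e f \<and> e \<le> a \<and> \<not> e \<le> q"
    if ab: "sup a b = top" and q: "q \<in> Max_Spec" "b \<le> q" for a b q :: 'a
  proof -
    \<comment> \<open>A maximal \<open>p\<close> above both would differ from \<open>q\<close>; the
      element separating on the side of \<open>q\<close> lies below \<open>s_map q\<close>, hence
      below \<open>p\<close>, together with its complement.\<close>
    have "sup a (s_map q) = top"
      unfolding sup_top_iff_Max_Spec
    proof (intro ballI notI)
      fix p assume p: "p \<in> Max_Spec" "a \<le> p \<and> s_map q \<le> p"
      have "p \<noteq> q" using ab p q unfolding sup_top_iff_Max_Spec by blast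
      then obtain e f where ef: "complementary e f" "e \<le> p" "f \<le> q" using S p q by blast
      then have "f \<le> s_map q" using complementary_le_s_map complementary_sym by blast
      then have "f \<le> p" using p by auto
      then show False using ef p complementary_prime_le Max_Spec_Spec by blast
    qed
    then obtain e f where "complementary e f" "e \<le> q" "f \<le> a" by (rule sup_s_map_top)
    then show ?thesis
      using complementary_prime_le[OF _ Max_Spec_Spec[OF q(1)]] complementary_sym by blast
  qed
  show "B_normal TYPE('a)"
    unfolding B_normal_iff_complementary
  proof (intro allI impI)
    fix a b :: 'a assume ab: "sup a b = top"
    \<comment> \<open>Every maximal \<open>q\<close> above \<open>b\<close> misses some complemented
      element below \<open>a\<close>, by the first round.\<close>
    have "sup b (s_map a) = top"
      unfolding sup_top_iff_Max_Spec
    proof (intro ballI notI)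
      fix q assume q: "q \<in> Max_Spec" "b \<le> q \<and> s_map a \<le> q"
      then obtain e f where ef: "complementary e f" "e \<le> a" "\<not> e \<le> q"
        using separate[OF ab] by blast
      then have "e \<le> s_map a" using complementary_le_s_map by blast
      then show False using ef q by auto
    qed
    then obtain e f where "complementary e f" "e \<le> a" "f \<le> b" by (rule sup_s_map_top)
    then show "\<exists>e f. complementary e f \<and> e \<le> a \<and> f \<le> b" by blast
  qed
qed

lemma separated_iff_complement:
  "(\<exists>e f. complementary e f \<and> e \<le> p \<and> f \<le> q) \<longleftrightarrow>
    (\<exists>e\<in>complemented_elements. e \<le> p \<and> complement e \<le> q)"
proof
  assume "\<exists>e f. complementary e f \<and> e \<le> p \<and> f \<le> q"
  then obtain e f where ef: "complementary e f" "e \<le> p" "f \<le> q" by blast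
  then show "\<exists>e\<in>complemented_elements. e \<le> p \<and> complement e \<le> q"
    using complementary_imp_complemented(1)[OF ef(1)] complementary_complement[OF ef(1)] by auto
next
  assume "\<exists>e\<in>complemented_elements. e \<le> p \<and> complement e \<le> q"
  then obtain e f where ef: "complementary e f" "e \<le> p" "complement e \<le> q"
    using complemented_elements_iff by blast
  then show "\<exists>e f. complementary e f \<and> e \<le> p \<and> f \<le> q"
    using complementary_complement[OF ef(1)] by auto
qed


section \<open>The topology of the maximal spectrum\<close>

lemma openin_Max_Z: "openin Max_Z U \<longleftrightarrow> (\<exists>a. U = basic_open a \<inter> Max_Spec)"
  by (auto simp: Max_Z_def openin_subtopology openin_Spec_Z)

lemma topspace_Max_Z: "topspace Max_Z = Max_Spec"
  using Max_Spec_subset_Spec by (auto simp: Max_Z_def topspace_Spec_Z)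

lemma mem_basic_open_Max: "p \<in> basic_open a \<inter> Max_Spec \<longleftrightarrow> p \<in> Max_Spec \<and> \<not> a \<le> p"
  using Max_Spec_Spec by (auto simp: basic_open_def)

lemma is_basis_iff:
  "is_basis X \<B> \<longleftrightarrow> (\<forall>V\<in>\<B>. openin X V) \<and> (\<forall>U x. openin X U \<and> x \<in> U \<longrightarrow> (\<exists>V\<in>\<B>. x \<in> V \<and> V \<subseteq> U))"
  unfolding is_basis_def openin_topology_base_unique by blast

lemma compact_space_Max_Z: "compact_space (Max_Z :: 'a::coherent_quantale topology)"
  unfolding compact_space_alt topspace_Max_Z
proof (intro allI impI)
  fix \<U> :: "'a set set"
  assume U: "(\<forall>U\<in>\<U>. openin Max_Z U) \<and> Max_Spec \<subseteq> \<Union>\<U>"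
  let ?D = "\<lambda>a. basic_open a \<inter> Max_Spec"
  \<comment> \<open>Collecting all elements that represent members of the cover avoids choosing
    representatives.\<close>
  let ?X = "{a. ?D a \<in> \<U>}"
  have "Sup ?X = top"
  proof (rule ccontr)
    assume "Sup ?X \<noteq> top"
    then obtain m where m: "m \<in> Max_Spec" "Sup ?X \<le> m" by (rule exists_Max_Spec_above)
    then obtain V where V: "V \<in> \<U>" "m \<in> V" using U by blast
    then obtain a where a: "V = ?D a" using U openin_Max_Z by blast
    then have "a \<le> m" using V m by (auto simp: Sup_le_iff)
    then show False using V(2) a by (auto simp: basic_open_def)
  qed
  then obtain F where F: "F \<subseteq> ?X" "finite F" "Sup F = top"
    using compact_top unfolding compact_element_def by (metis top_greatest top_unique)
  have "Max_Spec \<subseteq> \<Union>(?D ` F)"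
  proof
    fix m :: 'a assume m: "m \<in> Max_Spec"
    then have "\<not> Sup F \<le> m" using F(3) by (auto simp: Max_Spec_def top_unique)
    then show "m \<in> \<Union>(?D ` F)"
      using m Max_Spec_Spec by (auto simp: Sup_le_iff basic_open_def)
  qed
  then show "\<exists>\<F>. finite \<F> \<and> \<F> \<subseteq> \<U> \<and> Max_Spec \<subseteq> \<Union>\<F>"
    using F by (intro exI[of _ "?D ` F"]) auto
qed

lemma Max_Z_closedin_complementary:
  assumes "complementary e f"
  shows "closedin Max_Z (basic_open e \<inter> Max_Spec)"
proof -
  have "Max_Spec - basic_open e \<inter> Max_Spec = basic_open f \<inter> Max_Spec"
    using complementary_prime_le[OF assms] Max_Spec_Spec by (auto simp: basic_open_def)
  then show ?thesis by (auto simp: closedin_def topspace_Max_Z openin_Max_Z)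
qed

text \<open>For a maximal \<open>p\<close> in the open set of \<open>a\<close>, splitting
  \<open>sup a p = top\<close> yields the basic neighbourhood. Conversely, a basic neighbourhood of
  \<open>q\<close> that misses \<open>p\<close> separates the two.\<close>

lemma B_normal_iff_basis:
  "B_normal TYPE('a::coherent_quantale) \<longleftrightarrow>
    is_basis Max_Z ((\<lambda>e :: 'a. basic_open e \<inter> Max_Spec) ` complemented_elements)"
proof
  assume B: "B_normal TYPE('a)"
  have base: "\<exists>e\<in>complemented_elements. p \<in> basic_open e \<inter> Max_Spec \<and>
      basic_open e \<inter> Max_Spec \<subseteq> basic_open a \<inter> Max_Spec"
    if p: "p \<in> basic_open a \<inter> Max_Spec" for a p :: 'a
  proof -
    have p': "p \<in> Max_Spec" "\<not> a \<le> p" using p mem_basic_open_Max by blast+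
    then have "sup a p = top" by (metis Max_Spec_sup_top sup.commute)
    then obtain e f where ef: "complementary e f" "e \<le> a" "f \<le> p"
      using B unfolding B_normal_iff_complementary by blast
    then have "\<not> e \<le> p" using complementary_prime_le Max_Spec_Spec p' by blast
    moreover have "basic_open e \<inter> Max_Spec \<subseteq> basic_open a \<inter> Max_Spec"
      using ef(2) order_trans by (auto simp: basic_open_def)
    moreover have "p \<in> basic_open e \<inter> Max_Spec"
      using \<open>\<not> e \<le> p\<close> p'(1) mem_basic_open_Max by blast
    ultimately show ?thesis using complementary_imp_complemented(1)[OF ef(1)] by (intro bexI conjI)
  qed
  show "is_basis Max_Z ((\<lambda>e :: 'a. basic_open e \<inter> Max_Spec) ` complemented_elements)"
    unfolding is_basis_iff
  proof (intro conjI ballI allI impI)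
    fix U :: "'a set" and p assume U: "openin Max_Z U \<and> p \<in> U"
    then obtain a where "U = basic_open a \<inter> Max_Spec" using openin_Max_Z by blast
    then show "\<exists>V\<in>(\<lambda>e. basic_open e \<inter> Max_Spec) ` complemented_elements. p \<in> V \<and> V \<subseteq> U"
      using U base[of p a] by simp
  qed (auto simp: openin_Max_Z)
next
  assume basis: "is_basis Max_Z ((\<lambda>e :: 'a. basic_open e \<inter> Max_Spec) ` complemented_elements)"
  show "B_normal TYPE('a)"
    unfolding B_normal_iff_separated
  proof (intro ballI impI)
    fix p q :: 'a assume pq: "p \<in> Max_Spec" "q \<in> Max_Spec" "p \<noteq> q"
    \<comment> \<open>The trace of \<open>basic_open p\<close> is the set of all maximal elements
      other than \<open>p\<close>.\<close>
    then have "q \<in> basic_open p \<inter> Max_Spec"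
      using Max_Spec_distinct_not_le[of q p] by (simp add: mem_basic_open_Max del: Int_iff)
    moreover have "openin Max_Z (basic_open p \<inter> Max_Spec)" using openin_Max_Z by blast
    ultimately have "\<exists>V\<in>(\<lambda>e. basic_open e \<inter> Max_Spec) ` complemented_elements.
        q \<in> V \<and> V \<subseteq> basic_open p \<inter> Max_Spec"
      using basis unfolding is_basis_iff by metis
    then obtain e where e: "e \<in> complemented_elements" "q \<in> basic_open e \<inter> Max_Spec"
      "basic_open e \<inter> Max_Spec \<subseteq> basic_open p \<inter> Max_Spec" by blast
    then have "\<not> e \<le> q" "e \<le> p" using pq mem_basic_open_Max by blast+
    then show "\<exists>e f. complementary e f \<and> e \<le> p \<and> f \<le> q"
      using e(1) pq complementary_prime_le Max_Spec_Spec complemented_elements_iff by metis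
  qed
qed

section \<open>Normality and zero-dimensionality\<close>

lemma B_normal_imp_normal:
  "B_normal TYPE('a::coherent_quantale) \<Longrightarrow> normal_quantale TYPE('a)"
  unfolding normal_quantale_def
proof (intro allI impI)
  fix a b :: 'a assume "B_normal TYPE('a)" "sup a b = top"
  then obtain e f where ef: "complementary e f" "e \<le> a" "f \<le> b"
    unfolding B_normal_iff_complementary by blast
  then have "sup a f = top" "sup b e = top" "f * e = bot"
    using complementary_le_iff[OF ef(1)] complementary_le_iff[OF complementary_sym[OF ef(1)]]
      complementary_sym[OF ef(1)] by (simp_all add: complementary_def)
  then show "\<exists>e f. sup a e = top \<and> sup b f = top \<and> e * f = bot" by blast
qed

lemma B_normal_imp_zero_dimensional:
  assumes "B_normal TYPE('a::coherent_quantale)"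
  shows "zero_dimensional_space (Max_Z :: 'a topology)"
proof -
  let ?B = "(\<lambda>e :: 'a. basic_open e \<inter> Max_Spec) ` complemented_elements"
  have basis: "is_basis Max_Z ?B" using assms unfolding B_normal_iff_basis .
  moreover have "openin Max_Z V \<and> closedin Max_Z V" if V: "V \<in> ?B" for V
  proof
    show "openin Max_Z V" using V openin_Max_Z by blast
    obtain e f where "V = basic_open e \<inter> Max_Spec" "complementary e f"
      using V complemented_elements_iff by blast
    then show "closedin Max_Z V" using Max_Z_closedin_complementary by simp
  qed
  ultimately show ?thesis unfolding zero_dimensional_space_def by blast
qed

lemma B_normal_imp_Hausdorff:
  assumes "B_normal TYPE('a::coherent_quantale)"
  shows "Hausdorff_space (Max_Z :: 'a topology)"
  unfolding Hausdorff_space_def topspace_Max_Z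
proof (intro allI impI)
  fix p q :: 'a assume pq: "p \<in> Max_Spec \<and> q \<in> Max_Spec \<and> p \<noteq> q"
  then obtain e f where ef: "complementary e f" "e \<le> p" "f \<le> q"
    using assms unfolding B_normal_iff_separated by blast
  have *: "m \<in> basic_open e \<inter> Max_Spec \<longleftrightarrow> m \<in> Max_Spec \<and> f \<le> m"
    "m \<in> basic_open f \<inter> Max_Spec \<longleftrightarrow> m \<in> Max_Spec \<and> e \<le> m" for m
    using complementary_prime_le[OF ef(1) Max_Spec_Spec] mem_basic_open_Max by blast+
  have "p \<in> basic_open f \<inter> Max_Spec" "q \<in> basic_open e \<inter> Max_Spec"
    using * pq ef by blast+
  moreover have "disjnt (basic_open f \<inter> Max_Spec) (basic_open e \<inter> Max_Spec)"
    using * mem_basic_open_Max unfolding disjnt_def by blast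
  ultimately show "\<exists>U V. openin Max_Z U \<and> openin Max_Z V \<and> p \<in> U \<and> q \<in> V \<and> disjnt U V"
    using openin_Max_Z by blast
qed

lemma normal_zero_dimensional_imp_B_normal:
  assumes normal: "normal_quantale TYPE('a::coherent_quantale)"
    and zero: "zero_dimensional_space (Max_Z :: 'a topology)"
  shows "B_normal TYPE('a)"
  unfolding B_normal_iff_separated
proof (intro ballI impI)
  fix p q :: 'a assume pq: "p \<in> Max_Spec" "q \<in> Max_Spec" "p \<noteq> q"
  then have p: "p \<in> basic_open q \<inter> Max_Spec"
    using Max_Spec_distinct_not_le[of p q] by (simp add: mem_basic_open_Max del: Int_iff)
  have "openin Max_Z (basic_open q \<inter> Max_Spec)" using openin_Max_Z by blast
  with p obtain U where U: "openin Max_Z U" "closedin Max_Z U" "p \<in> U" "U \<subseteq> basic_open q \<inter> Max_Spec"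
    using zero unfolding zero_dimensional_space_def is_basis_iff by metis
  then have "q \<notin> U" using mem_basic_open_Max by blast
  obtain a where a: "U = basic_open a \<inter> Max_Spec" using U(1) openin_Max_Z by blast
  obtain b where b: "Max_Spec - U = basic_open b \<inter> Max_Spec"
    using U(2) unfolding closedin_def topspace_Max_Z openin_Max_Z by blast
  have ab: "a \<le> m \<longleftrightarrow> \<not> b \<le> m" if "m \<in> Max_Spec" for m
    using that a b mem_basic_open_Max by blast
  then have "sup a b = top" unfolding sup_top_iff_Max_Spec by blast
  then obtain x y where xy: "sup a x = top" "sup b y = top" "x * y = bot"
    using normal unfolding normal_quantale_def by blast
  have prime: "x \<le> m \<or> y \<le> m" if "m \<in> Max_Spec" for m
    using xy(3) Spec_mult_le_iff[OF Max_Spec_Spec[OF that], of x y] by simp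
  have not: "\<not> (a \<le> m \<and> x \<le> m)" "\<not> (b \<le> m \<and> y \<le> m)" if "m \<in> Max_Spec" for m
    using xy(1,2) that unfolding sup_top_iff_Max_Spec by blast+
  \<comment> \<open>A maximal element above both \<open>x\<close> and \<open>y\<close> could be
    above neither \<open>a\<close> nor \<open>b\<close>, but each is above one of these.\<close>
  have "sup x y = top" unfolding sup_top_iff_Max_Spec using ab not by blast
  then have "complementary x y" using xy(3) by (simp add: complementary_def)
  moreover have "\<not> a \<le> p" "a \<le> q"
    using U(3) \<open>q \<notin> U\<close> pq a mem_basic_open_Max by blast+
  \<comment> \<open>Since \<open>b \<le> p\<close>, the element \<open>y\<close> is not below
    \<open>p\<close>, so \<open>x\<close> is; symmetrically for \<open>q\<close> with
    \<open>a\<close>.\<close>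
  then have "x \<le> p" "y \<le> q" using ab not prime pq by blast+
  ultimately show "\<exists>e f. complementary e f \<and> e \<le> p \<and> f \<le> q" by blast
qed


section \<open>The Pierce spectrum\<close>

text \<open>If a regular proper \<open>x\<close> above \<open>s_map p\<close> had a complemented
  part \<open>e\<close> not below \<open>p\<close>, the complement of \<open>e\<close> would be
  below \<open>p\<close>, hence below \<open>x\<close>, and \<open>x\<close> would be
  \<open>top\<close>.\<close>

lemma s_map_Sp:
  assumes p: "p \<in> Spec"
  shows "s_map p \<in> Sp"
proof -
  have "s_map p \<le> p" unfolding s_map_def by (auto intro: Sup_least)
  moreover have "p < top" using p by (simp add: Spec_def)
  ultimately have "s_map p < top" by (rule order_le_less_trans)
  then have "s_map p \<noteq> top" by simp
  moreover have "regular (s_map p)"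
    unfolding regular_def s_map_def
    by (rule exI[of _ "{e \<in> complemented_elements. e \<le> p}"]) simp
  moreover have "x = s_map p" if x: "regular x" "x \<noteq> top" "s_map p \<le> x" for x
  proof (rule order_antisym)
    obtain X where X: "X \<subseteq> complemented_elements" "x = Sup X" using x(1) regular_def by blast
    show "x \<le> s_map p"
      unfolding X(2)
    proof (rule Sup_least)
      fix e assume e: "e \<in> X"
      then obtain f where ef: "complementary e f" using X complemented_elements_iff by blast
      have "\<not> f \<le> p"
      proof
        assume "f \<le> p"
        then have "f \<le> x"
          using complementary_le_s_map ef complementary_sym x(3) order_trans by blast
        moreover have "e \<le> x" using e X by (simp add: Sup_upper)
        ultimately show False using ef x(2) by (metis complementary_def le_sup_iff top_unique)
      qed
      then show "e \<le> s_map p" using complementary_prime_le complementary_le_s_map ef p by blast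
    qed
  qed (fact x(3))
  ultimately show ?thesis unfolding Sp_def by blast
qed

text \<open>A max-regular \<open>t\<close> lies below a maximal \<open>m\<close>; being regular it
  lies below \<open>s_map m\<close>, and its maximality gives equality.\<close>

lemma s_map_image_Max_Spec: "s_map ` Max_Spec = (Sp :: 'a::coherent_quantale set)"
proof
  show "s_map ` Max_Spec \<subseteq> (Sp :: 'a set)" using s_map_Sp Max_Spec_Spec by blast
  show "(Sp :: 'a set) \<subseteq> s_map ` Max_Spec"
  proof
    fix t :: 'a assume t: "t \<in> Sp"
    then have "t \<noteq> top" by (simp add: Sp_def)
    then obtain m where m: "m \<in> Max_Spec" "t \<le> m" by (rule exists_Max_Spec_above)
    obtain X where X: "X \<subseteq> complemented_elements" "t = Sup X"
      using t by (auto simp: Sp_def regular_def)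
    have "t \<le> s_map m"
      unfolding X(2) s_map_def using X m by (intro Sup_subset_mono) (auto simp: Sup_le_iff)
    moreover have "s_map m \<in> Sp" using s_map_Sp Max_Spec_Spec m(1) by blast
    ultimately have "s_map m = t" using t by (auto simp: Sp_def)
    then show "t \<in> s_map ` Max_Spec" using m(1) by blast
  qed
qed

lemma s_map_preimage_basic:
  assumes "complementary e f"
  shows "{p \<in> Max_Spec. s_map p \<in> Sp_basic_open e} = basic_open e \<inter> Max_Spec"
  using complementary_le_s_map[OF assms] s_map_Sp Max_Spec_Spec
  by (auto simp: Sp_basic_open_def basic_open_def)

text \<open>Surjectivity onto \<open>Sp\<close> turns the preimage formula into an image formula,
  from which openness of the map follows.\<close>

lemma s_map_image_basic:
  fixes e f :: "'a::coherent_quantale"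
  assumes "complementary e f"
  shows "s_map ` (basic_open e \<inter> Max_Spec) = Sp_basic_open e"
  unfolding s_map_preimage_basic[OF assms, symmetric]
  using s_map_image_Max_Spec by (auto simp: Sp_basic_open_def)

text \<open>The value \<open>s_map p\<close> and the set of complemented elements below
  \<open>p\<close> determine each other. Two values differ when a complemented element is below just
  one of the primes, and its complement is then below the other.\<close>

lemma inj_on_s_map_iff_separated:
  "inj_on s_map (Max_Spec :: 'a::quantale set) \<longleftrightarrow>
    (\<forall>p\<in>Max_Spec. \<forall>q\<in>Max_Spec. p \<noteq> q \<longrightarrow> (\<exists>e f :: 'a. complementary e f \<and> e \<le> p \<and> f \<le> q))"
proof
  assume inj: "inj_on s_map (Max_Spec :: 'a set)"
  have "\<exists>e f. complementary e f \<and> e \<le> p \<and> f \<le> q"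
    if pq: "p \<in> Max_Spec" "q \<in> Max_Spec" "p \<noteq> q" for p q :: 'a
  proof -
    have "s_map p \<noteq> s_map q" using inj pq by (auto dest: inj_onD)
    then have "{e \<in> complemented_elements. e \<le> p} \<noteq> {e \<in> complemented_elements. e \<le> q}"
      unfolding s_map_def by metis
    then obtain e f where "complementary e f" "(e \<le> p) \<noteq> (e \<le> q)"
      using complemented_elements_iff by blast
    then show ?thesis
      using pq complementary_prime_le Max_Spec_Spec complementary_sym by metis
  qed
  then show "\<forall>p\<in>Max_Spec. \<forall>q\<in>Max_Spec. p \<noteq> q \<longrightarrow> (\<exists>e f :: 'a. complementary e f \<and> e \<le> p \<and> f \<le> q)"
    by blast
next
  assume S: "\<forall>p\<in>Max_Spec. \<forall>q\<in>Max_Spec. p \<noteq> q \<longrightarrow> (\<exists>e f :: 'a. complementary e f \<and> e \<le> p \<and> f \<le> q)"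
  show "inj_on s_map (Max_Spec :: 'a set)"
  proof (rule inj_onI, rule ccontr)
    fix p q :: 'a assume pq: "p \<in> Max_Spec" "q \<in> Max_Spec" "s_map p = s_map q" "p \<noteq> q"
    then obtain e f where ef: "complementary e f" "e \<le> p" "f \<le> q" using S by blast
    then have "e \<le> q" using complementary_le_s_map pq(3) by metis
    then show False using ef pq complementary_prime_le Max_Spec_Spec by blast
  qed
qed

lemma continuous_map_s_map: "continuous_map (Max_Z :: 'a::quantale topology) Sp_topology s_map"
proof (rule continuous_map_into_topology_base[OF openin_Sp_topology])
  fix V :: "'a set" assume "V \<in> Sp_basic_open ` complemented_elements"
  then obtain e f where "V = Sp_basic_open e" "complementary e f"
    using complemented_elements_iff by blast
  then show "openin Max_Z {p \<in> topspace Max_Z. s_map p \<in> V}"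
    using s_map_preimage_basic openin_Max_Z topspace_Max_Z by metis
qed (use s_map_Sp Max_Spec_Spec in \<open>auto simp: topspace_Max_Z topspace_Sp_topology\<close>)

text \<open>Injectivity of \<open>s_map\<close> is separation of maximal elements. Under B-normality
  open sets are unions of traces of complemented elements, whose images are basic open, so the
  continuous bijection is open.\<close>

lemma B_normal_iff_homeomorphic:
  "B_normal TYPE('a::coherent_quantale) \<longleftrightarrow>
    homeomorphic_map (Max_Z :: 'a topology) Sp_topology s_map"
proof
  assume "homeomorphic_map (Max_Z :: 'a topology) Sp_topology s_map"
  then show "B_normal TYPE('a)"
    using homeomorphic_imp_injective_map
    unfolding B_normal_iff_separated topspace_Max_Z inj_on_s_map_iff_separated[symmetric]
    by (metis topspace_Max_Z)
next
  assume B: "B_normal TYPE('a)"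
  show "homeomorphic_map (Max_Z :: 'a topology) Sp_topology s_map"
  proof (rule bijective_open_imp_homeomorphic_map)
    show "open_map (Max_Z :: 'a topology) Sp_topology s_map"
      unfolding open_map_def
    proof (intro allI impI)
      fix U :: "'a set" assume "openin Max_Z U"
      then obtain \<V> where V: "\<V> \<subseteq> (\<lambda>e. basic_open e \<inter> Max_Spec) ` complemented_elements" "U = \<Union>\<V>"
        using B unfolding B_normal_iff_basis is_basis_def union_of_def by auto
      have "openin Sp_topology (s_map ` W)" if "W \<in> \<V>" for W
      proof -
        obtain e where e: "e \<in> complemented_elements" "W = basic_open e \<inter> Max_Spec"
          using V(1) \<open>W \<in> \<V>\<close> by blast
        then have "s_map ` W \<in> Sp_basic_open ` complemented_elements"
          using s_map_image_basic complemented_elements_iff by blast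
        then show ?thesis
          unfolding openin_Sp_topology by (rule arbitrary_union_of_inc)
      qed
      then show "openin Sp_topology (s_map ` U)"
        unfolding V(2) image_Union by blast
    qed
  qed (use B in \<open>auto simp: continuous_map_s_map topspace_Max_Z topspace_Sp_topology
      s_map_image_Max_Spec inj_on_s_map_iff_separated B_normal_iff_separated\<close>)
qed

theorem theorem7p13:
  fixes lam :: "'a::coherent_quantale \<Rightarrow> 'l::{distrib_lattice,bounded_lattice}"
  assumes "is_reticulation lam"
  shows
    "(B_normal TYPE('a) \<longleftrightarrow> B_normal_frame TYPE('a radical)) \<and>
     (B_normal TYPE('a) \<longleftrightarrow> B_normal_lattice TYPE('l)) \<and>
     (B_normal TYPE('a) \<longleftrightarrow>
        (\<forall>p\<in>Max_Spec. \<forall>q\<in>(Max_Spec :: 'a set). p \<noteq> q \<longrightarrow>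
           (\<exists>e\<in>complemented_elements. e \<le> p \<and> complement e \<le> q))) \<and>
     (B_normal TYPE('a) \<longleftrightarrow>
        normal_quantale TYPE('a) \<and> zero_dimensional_space (Max_Z :: 'a topology)) \<and>
     (B_normal TYPE('a) \<longleftrightarrow>
        normal_quantale TYPE('a) \<and> Boolean_space (Max_Z :: 'a topology)) \<and>
     (B_normal TYPE('a) \<longleftrightarrow>
        is_basis Max_Z ((\<lambda>e :: 'a. basic_open e \<inter> Max_Spec) ` complemented_elements)) \<and>
     (B_normal TYPE('a) \<longleftrightarrow>
        homeomorphic_map (Max_Z :: 'a topology) Sp_topology s_map)"
  \<comment> \<open>The two topological conditions under normality close up in a cycle: B-normality
    gives the Boolean space, which includes zero-dimensionality, and this leads back to
    B-normality.\<close>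
  using B_normal_radical_iff[where 'a='a] B_normal_reticulation_iff[OF assms]
    B_normal_iff_separated[where 'a='a] B_normal_iff_basis[where 'a='a]
    B_normal_iff_homeomorphic[where 'a='a] B_normal_imp_normal[where 'a='a]
    B_normal_imp_zero_dimensional[where 'a='a] B_normal_imp_Hausdorff[where 'a='a]
    normal_zero_dimensional_imp_B_normal[where 'a='a] compact_space_Max_Z[where 'a='a]
  unfolding Boolean_space_def separated_iff_complement by blast

end
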